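(* Let $\widehat X_m$ be any optimal solution of problem (RC). Assume that $\|\mathcal{P}_{T^\perp}(F(\widetilde X_m)+\gamma_m\widetilde X_m)\|<1$. Then for any given $\kappa>1$, if $$\rho_m\ \ge\ \frac{\kappa\nu}{b_m}\Big\|\frac1m\mathcal{R}_\Omega^*(\xi)\Big\|,$$ the following inequality holds: $$\frac{1}{2m}\big\|\mathcal{R}_\Omega(\widehat X_m-\overline X)\big\|_2^2\ \le\ \sqrt{2r}\Big(a_m+\frac{b_m}{\kappa}\Big)\rho_m\|\widehat X_m-\overline X\|_F+\frac{\rho_m\gamma_m}{2}\big(\|\overline X\|_F^2-\|\widehat X_m\|_F^2\big).$$
   Context: Let $\mathbb{V}^{n_1\times n_2}$ denote one of $\mathbb{R}^{n_1\times n_2}$, $\mathbb{C}^{n_1\times n_2}$, the real symmetric $n\times n$ matrices, or the Hermitian $n\times n$ matrices (in the last two cases $n_1=n_2=n$; in the first two $n=\min(n_1,n_2)$), regarded as a real inner product space with $\langle X,Y\rangle=\mathrm{Re}\,\mathrm{Tr}(X^{\mathbb{T}}Y)$, where $^{\mathbb{T}}$ is transpose (real case) or conjugate transpose (complex case); $\|\cdot\|$, $\|\cdot\|_*$, $\|\cdot\|_F$ denote spectral, nuclear and Frobenius norms. Let $\{\Theta_1,\dots,\Theta_d\}$ be an orthonormal basis of $\mathbb{V}^{n_1\times n_2}$, $\alpha\subseteq\{1,\dots,d\}$, $\beta=\{1,\dots,d\}\setminus\alpha$, $d_1=|\alpha|$, $d_2=|\beta|$. For $\pi\subseteq\{1,\dots,d\}$,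 $\mathcal{R}_\pi(X)=(\langle\Theta_k,X\rangle)_{k\in\pi}$. The unknown matrix $\overline X\in\mathbb{V}^{n_1\times n_2}$ has rank $r\ge1$. Given indices $\omega_1,\dots,\omega_m\in\beta$, noise $\xi=(\xi_1,\dots,\xi_m)\in\mathbb{R}^m$ and $\nu>0$, the observations are $y_i=\langle\Theta_{\omega_i},\overline X\rangle+\nu\xi_i$; $\mathcal{R}_\Omega(X)=(\langle\Theta_{\omega_1},X\rangle,\dots,\langle\Theta_{\omega_m},X\rangle)^{\mathbb{T}}$ and $\mathcal{R}_\Omega^*(z)=\sum_{i=1}^m z_i\Theta_{\omega_i}$. A function $f:\mathbb{R}^n\to\mathbb{R}^n$ is symmetric if $f(x)=Q^{\mathbb{T}}f(Qx)$ for all signed permutation matrices $Q$; its spectral operator is $F(X)=U\mathrm{Diag}(f(\sigma(X)))V^{\mathbb{T}}$, where $\sigma(X)$ is the vector of singular values in nonincreasing order and $X=U\mathrm{Diag}(\sigma(X))V^{\mathbb{T}}$ with $U,V$ orthogonal/unitary. Given an initial estimator $\widetilde X_m$ and parameters $\rho_m>0$, $\gamma_m\ge0$, problem (RC) is $$\min_{X\in\mathbb{V}^{n_1\times n_2}}\ \frac1{2m}\|y-\mathcal{R}_\Omega(X)\|_2^2+\rho_m\Big(\|X\|_*-\langle F(\widetilde X_m),X\rangle+\frac{\gamma_m}{2}\|X-\widetilde X_m\|_F^2\Big)\quad\text{s.t. }\mathcal{R}_\alpha(X)=\mathcal{R}_\alpha(\overline X).$$ Fix $\overline X=\overline U\mathrm{Diag}(\sigma(\overline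 X))\overline V^{\mathbb{T}}$ with $\overline U=[\overline U_1\ \overline U_2]$, $\overline V=[\overline V_1\ \overline V_2]$, $\overline U_1,\overline V_1$ having $r$ columns. Define $\mathcal{P}_T(X)=\overline U_1\overline U_1^{\mathbb{T}}X+X\overline V_1\overline V_1^{\mathbb{T}}-\overline U_1\overline U_1^{\mathbb{T}}X\overline V_1\overline V_1^{\mathbb{T}}$ and $\mathcal{P}_{T^\perp}(X)=\overline U_2\overline U_2^{\mathbb{T}}X\overline V_2\overline V_2^{\mathbb{T}}$, and $$a_m=\|\overline U_1\overline V_1^{\mathbb{T}}-\mathcal{P}_T(F(\widetilde X_m)+\gamma_m\widetilde X_m)\|,\qquad b_m=1-\|\mathcal{P}_{T^\perp}(F(\widetilde X_m)+\gamma_m\widetilde X_m)\|.$$ *)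

theory Defs
  imports "HOL-Analysis.Analysis" "Jordan_Normal_Form.Schur_Decomposition" "Jordan_Normal_Form.DL_Rank"
begin

text \<open>All four matrix spaces are realised as real subspaces of complex n1 x n2 matrices
  (JNF type complex mat). Conjugate transpose is mat_adjoint.\<close>

datatype space_kind = RealMat | ComplexMat | SymMat | HermMat

definition real_entries :: "complex mat \<Rightarrow> bool" where
  "real_entries X \<longleftrightarrow> (\<forall>i<dim_row X. \<forall>j<dim_col X. X $$ (i,j) \<in> \<real>)"

definition Vspace :: "space_kind \<Rightarrow> nat \<Rightarrow> nat \<Rightarrow> complex mat set" where
  "Vspace k n1 n2 = (case k of
      RealMat \<Rightarrow> {X \<in> carrier_mat n1 n2. real_entries X}
    | ComplexMat \<Rightarrow> carrier_mat n1 n2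
    | SymMat \<Rightarrow> {X \<in> carrier_mat n1 n2. n1 = n2 \<and> real_entries X \<and> transpose_mat X = X}
    | HermMat \<Rightarrow> {X \<in> carrier_mat n1 n2. n1 = n2 \<and> mat_adjoint X = X})"

text \<open>Real cases: orthogonal (real) factors; complex cases: unitary factors.\<close>
definition is_real_kind :: "space_kind \<Rightarrow> bool" where
  "is_real_kind k \<longleftrightarrow> k = RealMat \<or> k = SymMat"

definition minner :: "complex mat \<Rightarrow> complex mat \<Rightarrow> real" where
  "minner X Y = Re (\<Sum>i<dim_col X. (mat_adjoint X * Y) $$ (i,i))"

definition unitary :: "nat \<Rightarrow> complex mat \<Rightarrow> bool" where
  "unitary n U \<longleftrightarrow> U \<in> carrier_mat n n \<and> mat_adjoint U * U = 1\<^sub>m n \<and> U * mat_adjoint U = 1\<^sub>m n"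

definition rdiag :: "nat \<Rightarrow> nat \<Rightarrow> real vec \<Rightarrow> complex mat" where
  "rdiag n1 n2 s = mat n1 n2 (\<lambda>(i,j). if i = j then complex_of_real (s $ i) else 0)"

definition is_svd :: "complex mat \<Rightarrow> complex mat \<Rightarrow> real vec \<Rightarrow> complex mat \<Rightarrow> bool" where
  "is_svd X U s V \<longleftrightarrow>
     unitary (dim_row X) U \<and> unitary (dim_col X) V \<and>
     dim_vec s = min (dim_row X) (dim_col X) \<and>
     (\<forall>i<dim_vec s. 0 \<le> s $ i) \<and>
     (\<forall>i j. i \<le> j \<longrightarrow> j < dim_vec s \<longrightarrow> s $ j \<le> s $ i) \<and>
     X = U * rdiag (dim_row X) (dim_col X) s * mat_adjoint V"

definition is_svd_k :: "space_kind \<Rightarrow> complex mat \<Rightarrow> complex mat \<Rightarrow> real vec \<Rightarrow> complex mat \<Rightarrow> bool" where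
  "is_svd_k k X U s V \<longleftrightarrow> is_svd X U s V \<and>
     (is_real_kind k \<longrightarrow> real_entries U \<and> real_entries V)"

definition sing_vals :: "complex mat \<Rightarrow> real vec" where
  "sing_vals X = (THE s. \<exists>U V. is_svd X U s V)"

definition spec_norm :: "complex mat \<Rightarrow> real" where
  "spec_norm X = Max (insert 0 {sing_vals X $ i | i. i < dim_vec (sing_vals X)})"

definition nuc_norm :: "complex mat \<Rightarrow> real" where
  "nuc_norm X = (\<Sum>i<dim_vec (sing_vals X). sing_vals X $ i)"

definition fro_norm :: "complex mat \<Rightarrow> real" where
  "fro_norm X = sqrt (\<Sum>i<dim_row X. \<Sum>j<dim_col X. (cmod (X $$ (i,j)))\<^sup>2)"

definition signed_perm_mat :: "nat \<Rightarrow> real mat \<Rightarrow> bool" where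
  "signed_perm_mat n Q \<longleftrightarrow> Q \<in> carrier_mat n n \<and>
     (\<exists>p \<epsilon>. p permutes {..<n} \<and> (\<forall>i<n. \<epsilon> i = 1 \<or> \<epsilon> i = -1) \<and>
        (\<forall>i<n. \<forall>j<n. Q $$ (i,j) = (if j = p i then \<epsilon> i else 0)))"

definition symmetric_fun :: "nat \<Rightarrow> (real vec \<Rightarrow> real vec) \<Rightarrow> bool" where
  "symmetric_fun n f \<longleftrightarrow> (\<forall>x\<in>carrier_vec n. f x \<in> carrier_vec n) \<and>
     (\<forall>Q x. signed_perm_mat n Q \<longrightarrow> x \<in> carrier_vec n \<longrightarrow>
        f x = transpose_mat Q *\<^sub>v f (Q *\<^sub>v x))"

definition spectral_op :: "space_kind \<Rightarrow> (real vec \<Rightarrow> real vec) \<Rightarrow> complex mat \<Rightarrow> complex mat" where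
  "spectral_op k f X = (let (U, V) = (SOME (U, V). is_svd_k k X U (sing_vals X) V) in
      U * rdiag (dim_row X) (dim_col X) (f (sing_vals X)) * mat_adjoint V)"

definition mat_rank :: "complex mat \<Rightarrow> nat" where
  "mat_rank X = vec_space.rank (dim_row X) X"

definition first_cols :: "nat \<Rightarrow> complex mat \<Rightarrow> complex mat" where
  "first_cols r U = mat (dim_row U) r (\<lambda>(i,j). U $$ (i,j))"

definition last_cols :: "nat \<Rightarrow> complex mat \<Rightarrow> complex mat" where
  "last_cols r U = mat (dim_row U) (dim_col U - r) (\<lambda>(i,j). U $$ (i, j + r))"

definition P_T :: "complex mat \<Rightarrow> complex mat \<Rightarrow> complex mat \<Rightarrow> complex mat" where
  "P_T U1 V1 X = U1 * mat_adjoint U1 * X + X * V1 * mat_adjoint V1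
                 - U1 * mat_adjoint U1 * X * V1 * mat_adjoint V1"

definition P_Tperp :: "complex mat \<Rightarrow> complex mat \<Rightarrow> complex mat \<Rightarrow> complex mat" where
  "P_Tperp U2 V2 X = U2 * mat_adjoint U2 * X * V2 * mat_adjoint V2"

definition msum :: "nat \<Rightarrow> nat \<Rightarrow> ('i \<Rightarrow> complex mat) \<Rightarrow> 'i set \<Rightarrow> complex mat" where
  "msum n1 n2 g A = mat n1 n2 (\<lambda>(i,j). \<Sum>k\<in>A. g k $$ (i,j))"

definition orthonormal_basis :: "complex mat set \<Rightarrow> nat \<Rightarrow> (nat \<Rightarrow> complex mat) \<Rightarrow> bool" where
  "orthonormal_basis V d \<Theta> \<longleftrightarrow>
     (\<forall>k\<in>{1..d}. \<Theta> k \<in> V) \<and>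
     (\<forall>k\<in>{1..d}. \<forall>l\<in>{1..d}. minner (\<Theta> k) (\<Theta> l) = (if k = l then 1 else 0)) \<and>
     (\<forall>X\<in>V. \<exists>c :: nat \<Rightarrow> real. X = msum (dim_row X) (dim_col X) (\<lambda>k. complex_of_real (c k) \<cdot>\<^sub>m \<Theta> k) {1..d})"

definition R_Omega_adj :: "nat \<Rightarrow> nat \<Rightarrow> (nat \<Rightarrow> complex mat) \<Rightarrow> nat \<Rightarrow> (nat \<Rightarrow> nat) \<Rightarrow> (nat \<Rightarrow> real) \<Rightarrow> complex mat" where
  "R_Omega_adj n1 n2 \<Theta> m \<omega> z = msum n1 n2 (\<lambda>i. complex_of_real (z i) \<cdot>\<^sub>m \<Theta> (\<omega> i)) {1..m}"

definition resid_sq :: "(nat \<Rightarrow> complex mat) \<Rightarrow> nat \<Rightarrow> (nat \<Rightarrow> nat) \<Rightarrow> (nat \<Rightarrow> real) \<Rightarrow> complex mat \<Rightarrow> real" where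
  "resid_sq \<Theta> m \<omega> y X = (\<Sum>i=1..m. (y i - minner (\<Theta> (\<omega> i)) X)\<^sup>2)"

text \<open>Objective of problem (RC), with FX = F(Xtilde).\<close>
definition RC_obj :: "(nat \<Rightarrow> complex mat) \<Rightarrow> nat \<Rightarrow> (nat \<Rightarrow> nat) \<Rightarrow> (nat \<Rightarrow> real) \<Rightarrow> real \<Rightarrow> real
     \<Rightarrow> complex mat \<Rightarrow> complex mat \<Rightarrow> complex mat \<Rightarrow> real" where
  "RC_obj \<Theta> m \<omega> y \<rho> \<gamma> FX Xt X =
     1 / (2 * real m) * resid_sq \<Theta> m \<omega> y X
     + \<rho> * (nuc_norm X - minner FX X + \<gamma> / 2 * (fro_norm (X - Xt))\<^sup>2)"

definition RC_feasible :: "complex mat set \<Rightarrow> (nat \<Rightarrow> complex mat) \<Rightarrow> nat set \<Rightarrow> complex mat \<Rightarrow> complex mat \<Rightarrow> bool" where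
  "RC_feasible V \<Theta> \<alpha> Xbar X \<longleftrightarrow> X \<in> V \<and> (\<forall>k\<in>\<alpha>. minner (\<Theta> k) X = minner (\<Theta> k) Xbar)"

end

theory Submission
  imports
    Defs
    "Jordan_Normal_Form.Spectral_Radius"
begin

text \<open>Comparing the optimal value of (RC) with the feasible point \<open>Xbar\<close> reduces the claim to two
  estimates for \<open>D = Xh - Xbar\<close>: a lower bound for the growth of the nuclear norm, given by the
  subgradient inequality at \<open>Xbar\<close>, and an upper bound for linear functionals of \<open>D\<close>.
  Conjugating with the singular vectors of \<open>Xbar\<close> turns the tangent space projections into
  masking of matrix entries: \<open>P_T\<close> keeps the first \<open>r\<close> rows and columns and \<open>P_Tperp\<close> the
  complementary lower block. A matrix whose operator norm is at most \<open>c\<close> has rows and columns of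
  Euclidean norm at most \<open>c\<close>, so its masked part has Frobenius norm at most \<open>c * sqrt (2 * r)\<close>,
  while on the lower block spectral and nuclear norm are dual. The assumption on \<open>\<rho>\<close> makes the
  nuclear norm of the lower block of \<open>D\<close> enter with a nonpositive coefficient.\<close>

unbundle no vec_syntax

section \<open>Matrices, the real inner product and operator bounds\<close>

text \<open>Singular values are given by a definite description and the spectral operator by a
  choice, so nothing can be computed with either before a singular value decomposition is known to
  exist, with real factors for real matrices, and its values are known to be unique. This shapes the
  first half of the development. The kind of the space matters only for the feasibility of
  \<open>Xbar\<close> and for the factors of the spectral operator; dual matrices are taken among
  all complex matrices, so they may leave the space.

  The weight \<open>F + \<gamma> Xt\<close> comes from expanding the proximal square: its linear
  part joins the spectral operator and its norms form the last term of the claim. The noise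
  functional is bounded on the tangent part and on the lower block by one and the same spectral
  norm. Its tangential share is the summand \<open>b_m / \<kappa>\<close> of the claim, and its
  share on the lower block is paid for by the net gain \<open>b_m\<close> that remains there once
  the linear term of the regulariser is subtracted from the subgradient inequality.\<close>

lemma adj_dim [simp]: "dim_row (mat_adjoint A) = dim_col A" "dim_col (mat_adjoint A) = dim_row A"
  unfolding mat_adjoint_def by auto

lemma adj_carrier [simp]: "A \<in> carrier_mat n m \<Longrightarrow> mat_adjoint A \<in> carrier_mat m n"
  by auto

lemma adj_index [simp]:
  "i < dim_col A \<Longrightarrow> j < dim_row A \<Longrightarrow> mat_adjoint A $$ (i, j) = cnj (A $$ (j, i))"
  for A :: "complex mat"
  unfolding mat_adjoint_def by (simp add: mat_of_rows_index)

lemma mult_index: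
  "i < dim_row A \<Longrightarrow> j < dim_col B \<Longrightarrow> dim_col A = dim_row B \<Longrightarrow>
   (A * B) $$ (i, j) = (\<Sum>l<dim_row B. A $$ (i, l) * B $$ (l, j))"
  for A :: "complex mat"
  by (simp add: scalar_prod_def atLeast0LessThan)

lemma mult_vec_index:
  "i < dim_row A \<Longrightarrow> dim_col A = dim_vec x \<Longrightarrow>
   (A *\<^sub>v x) $ i = (\<Sum>l<dim_vec x. A $$ (i, l) * x $ l)"
  for A :: "complex mat"
  by (simp add: scalar_prod_def atLeast0LessThan)

lemma adj_adj [simp]: "mat_adjoint (mat_adjoint A) = A"
  for A :: "complex mat"
  by (rule eq_matI) auto

lemma adj_mult:
  fixes A B :: "complex mat"
  assumes "A \<in> carrier_mat n m" "B \<in> carrier_mat m p"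
  shows "mat_adjoint (A * B) = mat_adjoint B * mat_adjoint A"
  using assms by (intro eq_matI) (auto simp: mult_index mult.commute simp del: index_mult_mat(1))

text \<open>Side conditions on dimensions let the simplifier reassociate long products; premises
  about carriers would leave the inner sizes as variables that rewriting cannot instantiate.\<close>

lemma mult_assoc_dim:
  "dim_col A = dim_row B \<Longrightarrow> dim_col B = dim_row C \<Longrightarrow> A * B * C = A * (B * C)"
  for A B C :: "complex mat"
  by (rule assoc_mult_mat[of _ "dim_row A" "dim_row B" _ "dim_row C" _ "dim_col C"]) auto

lemma mult_vec_assoc_dim:
  "dim_col A = dim_row B \<Longrightarrow> dim_col B = dim_vec x \<Longrightarrow> A * B *\<^sub>v x = A *\<^sub>v (B *\<^sub>v x)"
  for A B :: "complex mat"
  by (rule assoc_mult_mat_vec[of _ "dim_row A" "dim_row B" _ "dim_col B"]) auto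

lemma adj_mult_dim: "dim_col A = dim_row B \<Longrightarrow> mat_adjoint (A * B) = mat_adjoint B * mat_adjoint A"
  for A B :: "complex mat"
  by (rule adj_mult[of _ "dim_row A" "dim_row B" _ "dim_col B"]) auto

lemma unitary_carrier [simp]: "unitary n U \<Longrightarrow> U \<in> carrier_mat n n"
  by (simp add: unitary_def)

lemma unitary_adj: "unitary n U \<Longrightarrow> unitary n (mat_adjoint U)"
  by (simp add: unitary_def)

lemma unitary_one: "unitary n (1\<^sub>m n)"
proof -
  have "mat_adjoint (1\<^sub>m n) = (1\<^sub>m n :: complex mat)"
    by (rule eq_matI) auto
  then show ?thesis by (simp add: unitary_def)
qed

lemma unitary_mult:
  assumes "unitary n U" "unitary n W"
  shows "unitary n (U * W)"
proof -
  have U: "U \<in> carrier_mat n n" "mat_adjoint U * U = 1\<^sub>m n" "U * mat_adjoint U = 1\<^sub>m n"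
    and W: "W \<in> carrier_mat n n" "mat_adjoint W * W = 1\<^sub>m n" "W * mat_adjoint W = 1\<^sub>m n"
    using assms by (auto simp: unitary_def)
  have "mat_adjoint W * mat_adjoint U * (U * W) = mat_adjoint W * (mat_adjoint U * U) * W"
    using U(1) W(1) by (simp add: mult_assoc_dim)
  moreover have "U * W * (mat_adjoint W * mat_adjoint U) = U * (W * mat_adjoint W) * mat_adjoint U"
    using U(1) W(1) by (simp add: mult_assoc_dim)
  ultimately show ?thesis
    using U W by (simp add: unitary_def adj_mult[of _ n n _ n])
qed

text \<open>The two directions of the change to singular vector coordinates,
  \<open>X \<mapsto> mat_adjoint U * X * V\<close>.\<close>

lemma unitary_cancel:
  fixes X Y :: "complex mat"
  assumes "unitary n U" "unitary m V" "X \<in> carrier_mat n m"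
  shows "mat_adjoint U * (U * X * mat_adjoint V) * V = X"
    and "U * (mat_adjoint U * X * V) * mat_adjoint V = X"
proof -
  have *: "A' * (A * X * B') * B = X"
    if "A \<in> carrier_mat n n" "A' \<in> carrier_mat n n" "B \<in> carrier_mat m m" "B' \<in> carrier_mat m m"
      "A' * A = 1\<^sub>m n" "B' * B = 1\<^sub>m m" for A A' B B'
  proof -
    have "A' * (A * X * B') * B = (A' * A) * X * (B' * B)"
      using that(1-4) assms(3) by (simp add: mult_assoc_dim)
    then show ?thesis using that assms(3) by simp
  qed
  show "mat_adjoint U * (U * X * mat_adjoint V) * V = X"
    using assms by (intro *) (auto simp: unitary_def)
  show "U * (mat_adjoint U * X * V) * mat_adjoint V = X"
    using assms by (intro *) (auto simp: unitary_def)
qed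

lemma real_entries_mult:
  assumes "real_entries A" "real_entries B" "dim_col A = dim_row B"
  shows "real_entries (A * B)"
  using assms unfolding real_entries_def
  by (auto simp: mult_index simp del: index_mult_mat(1) intro!: sum_in_Reals Reals_mult)

lemma real_entries_adj: "real_entries A \<Longrightarrow> real_entries (mat_adjoint A)"
  unfolding real_entries_def by (auto simp: complex_is_Real_iff)

lemma real_entries_one: "real_entries (1\<^sub>m n)"
  by (auto simp: real_entries_def)

section \<open>The real inner product and the Frobenius norm\<close>

lemma minner_entries:
  assumes "X \<in> carrier_mat n m" "Y \<in> carrier_mat n m"
  shows "minner X Y = (\<Sum>i<n. \<Sum>j<m. Re (cnj (X $$ (i, j)) * Y $$ (i, j)))"
proof -
  have "minner X Y = Re (\<Sum>j<m. \<Sum>i<n. cnj (X $$ (i, j)) * Y $$ (i, j))"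
    using assms by (simp add: minner_def mult_index del: index_mult_mat(1))
  also have "\<dots> = Re (\<Sum>i<n. \<Sum>j<m. cnj (X $$ (i, j)) * Y $$ (i, j))"
    by (subst sum.swap) simp
  finally show ?thesis by (simp only: Re_sum)
qed

lemma minner_diff_right:
  "X \<in> carrier_mat n m \<Longrightarrow> Y \<in> carrier_mat n m \<Longrightarrow> Z \<in> carrier_mat n m \<Longrightarrow>
   minner X (Y - Z) = minner X Y - minner X Z"
  by (simp add: minner_entries[of _ n m] sum_subtractf minus_carrier_mat algebra_simps)

lemma minner_commute:
  "X \<in> carrier_mat n m \<Longrightarrow> Y \<in> carrier_mat n m \<Longrightarrow> minner X Y = minner Y X"
  by (simp add: minner_entries[of _ n m] algebra_simps)

lemma minner_add_left:
  "X \<in> carrier_mat n m \<Longrightarrow> Y \<in> carrier_mat n m \<Longrightarrow> Z \<in> carrier_mat n m \<Longrightarrow>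
   minner (X + Y) Z = minner X Z + minner Y Z"
  by (simp add: minner_entries[of _ n m] sum.distrib algebra_simps)

lemma minner_diff_left:
  "X \<in> carrier_mat n m \<Longrightarrow> Y \<in> carrier_mat n m \<Longrightarrow> Z \<in> carrier_mat n m \<Longrightarrow>
   minner (X - Y) Z = minner X Z - minner Y Z"
  by (simp add: minner_entries[of _ n m] sum_subtractf minus_carrier_mat algebra_simps)

lemma minner_smult_left:
  "X \<in> carrier_mat n m \<Longrightarrow> Y \<in> carrier_mat n m \<Longrightarrow>
   minner (complex_of_real c \<cdot>\<^sub>m X) Y = c * minner X Y"
  by (simp add: minner_entries[of _ n m] sum_distrib_left algebra_simps)

lemma minner_mult_left:
  assumes "A \<in> carrier_mat n p" "X \<in> carrier_mat p m" "Y \<in> carrier_mat n m"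
  shows "minner (A * X) Y = minner X (mat_adjoint A * Y)"
  using assms by (simp add: minner_def adj_mult[of _ n p _ m] assoc_mult_mat[of _ m p _ n _ m])

text \<open>Associativity alone does not help here, since the factor stands at the other end of the
  trace; this is cyclicity of the trace, done by exchanging two sums.\<close>

lemma minner_mult_right:
  assumes "X \<in> carrier_mat n p" "B \<in> carrier_mat p m" "Y \<in> carrier_mat n m"
  shows "minner (X * B) Y = minner X (Y * mat_adjoint B)"
proof -
  have "minner (X * B) Y = (\<Sum>i<n. \<Sum>j<m. \<Sum>l<p. Re (cnj (X $$ (i, l) * B $$ (l, j)) * Y $$ (i, j)))"
    using assms by (simp add: minner_entries[of _ n m] mult_index sum_distrib_right del: index_mult_mat(1))
  also have "\<dots> = (\<Sum>i<n. \<Sum>l<p. \<Sum>j<m. Re (cnj (X $$ (i, l) * B $$ (l, j)) * Y $$ (i, j)))"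
    by (intro sum.cong refl sum.swap)
  also have "\<dots> = minner X (Y * mat_adjoint B)"
    using assms by (simp add: minner_entries[of _ n p] mult_index sum_distrib_left algebra_simps sum.distrib sum_subtractf sum_negf del: index_mult_mat(1))
  finally show ?thesis .
qed

lemma minner_unitary:
  assumes "unitary n U" "unitary m V" "X \<in> carrier_mat n m" "Y \<in> carrier_mat n m"
  shows "minner (U * X * mat_adjoint V) Y = minner X (mat_adjoint U * Y * V)"
proof -
  have U: "U \<in> carrier_mat n n" and V: "V \<in> carrier_mat m m"
    using assms by auto
  have "minner (U * X * mat_adjoint V) Y = minner (U * X) (Y * V)"
    using minner_mult_right[of "U * X" n m "mat_adjoint V" m Y] U V assms(3,4) by simp
  also have "\<dots> = minner X (mat_adjoint U * (Y * V))"
    using U V assms(3,4) by (intro minner_mult_left) auto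
  also have "mat_adjoint U * (Y * V) = mat_adjoint U * Y * V"
    using U V assms(4) by (simp add: mult_assoc_dim)
  finally show ?thesis .
qed

lemma fro_norm_sq: "X \<in> carrier_mat n m \<Longrightarrow> (fro_norm X)\<^sup>2 = minner X X"
  by (simp add: fro_norm_def minner_entries[of _ n m] sum_nonneg cmod_power2 flip: power2_eq_square)

lemma fro_norm_nonneg: "fro_norm X \<ge> 0"
  by (simp add: fro_norm_def sum_nonneg)

lemma fro_norm_unitary:
  assumes "unitary n U" "unitary m V" "X \<in> carrier_mat n m"
  shows "fro_norm (mat_adjoint U * X * V) = fro_norm X"
proof -
  have c: "mat_adjoint U * X * V \<in> carrier_mat n m"
    using assms by (auto simp: unitary_def)
  have "(fro_norm (mat_adjoint U * X * V))\<^sup>2 = (fro_norm X)\<^sup>2"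
    unfolding fro_norm_sq[OF c] fro_norm_sq[OF assms(3)]
    using minner_unitary[OF assms(1,2) c assms(3)] unitary_cancel(2)[OF assms] by simp
  then show ?thesis
    using fro_norm_nonneg power2_eq_iff_nonneg by blast
qed

lemma Cauchy_Schwarz_minner:
  assumes "X \<in> carrier_mat n m" "Y \<in> carrier_mat n m"
  shows "\<bar>minner X Y\<bar> \<le> fro_norm X * fro_norm Y"
proof -
  let ?I = "{..<n} \<times> {..<m}"
  have "\<bar>minner X Y\<bar> \<le> (\<Sum>p\<in>?I. \<bar>cmod (X $$ p)\<bar> * \<bar>cmod (Y $$ p)\<bar>)"
    unfolding minner_entries[OF assms] sum.cartesian_product
    by (intro order_trans[OF sum_abs] sum_mono)
      (auto simp: split_def norm_mult simp del: times_complex.sel intro: order_trans[OF abs_Re_le_cmod])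
  also have "\<dots> \<le> L2_set (\<lambda>p. cmod (X $$ p)) ?I * L2_set (\<lambda>p. cmod (Y $$ p)) ?I"
    by (rule L2_set_mult_ineq)
  also have "\<dots> = fro_norm X * fro_norm Y"
    using assms by (simp add: L2_set_def fro_norm_def sum.cartesian_product split_def)
  finally show ?thesis .
qed

section \<open>Squared vector norms and operator bounds\<close>

definition nsq :: "complex vec \<Rightarrow> real" where
  "nsq x = (\<Sum>i<dim_vec x. (cmod (x $ i))\<^sup>2)"

lemma nsq_nonneg: "nsq x \<ge> 0"
  by (simp add: nsq_def sum_nonneg)

lemma nsq_cscalar: "complex_of_real (nsq x) = (\<Sum>i<dim_vec x. cnj (x $ i) * x $ i)"
  unfolding nsq_def of_real_sum
  by (rule sum.cong) (simp_all only: complex_norm_square mult.commute)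

text \<open>Stated over the complex numbers so that an eigenvalue equation for the Gram matrix, or
  its being the identity, can be substituted on the right.\<close>

lemma nsq_mult_adj:
  assumes "A \<in> carrier_mat n m" "x \<in> carrier_vec m"
  shows "complex_of_real (nsq (A *\<^sub>v x)) =
     (\<Sum>j<m. cnj (x $ j) * ((mat_adjoint A * A) *\<^sub>v x) $ j)"
proof -
  have "complex_of_real (nsq (A *\<^sub>v x)) =
      (\<Sum>i<n. \<Sum>j<m. cnj (x $ j) * (cnj (A $$ (i, j)) * (A *\<^sub>v x) $ i))"
    using assms
    by (simp add: nsq_cscalar mult_vec_index sum_distrib_right sum_distrib_left ac_simps
        del: index_mult_mat_vec)
  also have "\<dots> = (\<Sum>j<m. \<Sum>i<n. cnj (x $ j) * (cnj (A $$ (i, j)) * (A *\<^sub>v x) $ i))"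
    by (rule sum.swap)
  also have "\<dots> = (\<Sum>j<m. cnj (x $ j) * (mat_adjoint A *\<^sub>v (A *\<^sub>v x)) $ j)"
    using assms by (simp add: mult_vec_index sum_distrib_left del: index_mult_mat_vec)
  finally show ?thesis
    using assms by (simp add: assoc_mult_mat_vec[of _ m n _ m] del: index_mult_mat_vec)
qed

lemma nsq_isometry:
  assumes "A \<in> carrier_mat n m" "mat_adjoint A * A = 1\<^sub>m m" "x \<in> carrier_vec m"
  shows "nsq (A *\<^sub>v x) = nsq x"
proof -
  have "complex_of_real (nsq (A *\<^sub>v x)) = complex_of_real (nsq x)"
    using assms by (simp only: nsq_mult_adj[OF assms(1,3)]) (simp add: nsq_cscalar)
  then show ?thesis using of_real_eq_iff by blast
qed

text \<open>Operator norm at most c, without a supremum. In this form the bound passes to unitary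
  multiples, rows, columns and submatrices by a suitable choice of x.\<close>

definition op_bound :: "real \<Rightarrow> complex mat \<Rightarrow> bool" where
  "op_bound c X \<longleftrightarrow> 0 \<le> c \<and> (\<forall>x\<in>carrier_vec (dim_col X). nsq (X *\<^sub>v x) \<le> c\<^sup>2 * nsq x)"

lemma op_bound_unitary:
  assumes "op_bound c X" "X \<in> carrier_mat n m" "unitary n U" "unitary m V"
  shows "op_bound c (U * X * V)"
proof -
  have U: "U \<in> carrier_mat n n" and V: "V \<in> carrier_mat m m"
    using assms by auto
  have "nsq (U * X * V *\<^sub>v x) \<le> c\<^sup>2 * nsq x" if x: "x \<in> carrier_vec m" for x
  proof -
    have "U * X * V *\<^sub>v x = U *\<^sub>v (X *\<^sub>v (V *\<^sub>v x))"
      using U V assms(2) x by (simp add: assoc_mult_mat_vec[of _ n m _ m] assoc_mult_mat_vec[of _ n n _ m])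
    then have "nsq (U * X * V *\<^sub>v x) = nsq (X *\<^sub>v (V *\<^sub>v x))"
      using nsq_isometry[OF U _ mult_mat_vec_carrier[OF assms(2) mult_mat_vec_carrier[OF V x]]] assms(3)
      by (simp add: unitary_def)
    also have "\<dots> \<le> c\<^sup>2 * nsq (V *\<^sub>v x)"
      using assms(1,2) mult_mat_vec_carrier[OF V x] by (auto simp: op_bound_def)
    also have "nsq (V *\<^sub>v x) = nsq x"
      using nsq_isometry[OF V _ x] assms(4) by (simp add: unitary_def)
    finally show ?thesis .
  qed
  then show ?thesis using assms by (auto simp: op_bound_def unitary_def)
qed

lemma op_bound_column:
  assumes "op_bound c X" "X \<in> carrier_mat n m" "j < m"
  shows "(\<Sum>i<n. (cmod (X $$ (i, j)))\<^sup>2) \<le> c\<^sup>2"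
proof -
  have "nsq (X *\<^sub>v unit_vec m j) \<le> c\<^sup>2 * nsq (unit_vec m j)"
    using assms by (auto simp: op_bound_def)
  moreover have "nsq (unit_vec m j) = 1"
    using assms(3) by (simp add: nsq_def if_distrib[of "\<lambda>x. (cmod x)\<^sup>2"] cong: if_cong)
  moreover have "X *\<^sub>v unit_vec m j = col X j"
    using assms by (intro eq_vecI) (auto simp: scalar_prod_right_unit)
  ultimately show ?thesis using assms by (simp add: nsq_def)
qed

text \<open>Test with the conjugated row i: entry i of the image is the squared row length s, so s^2
  \<le> c^2 s. This avoids transferring the bound to the adjoint.\<close>

lemma op_bound_row:
  assumes "op_bound c X" "X \<in> carrier_mat n m" "i < n"
  shows "(\<Sum>j<m. (cmod (X $$ (i, j)))\<^sup>2) \<le> c\<^sup>2"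
proof -
  define x where "x = vec m (\<lambda>j. cnj (X $$ (i, j)))"
  have x: "x \<in> carrier_vec m" "nsq x = (\<Sum>j<m. (cmod (X $$ (i, j)))\<^sup>2)"
    by (simp_all add: x_def nsq_def)
  have "(X *\<^sub>v x) $ i = complex_of_real (nsq x)"
    using assms by (simp add: mult_vec_index nsq_cscalar x_def mult.commute del: index_mult_mat_vec)
  moreover have "(cmod ((X *\<^sub>v x) $ i))\<^sup>2 \<le> nsq (X *\<^sub>v x)"
    unfolding nsq_def using assms by (intro member_le_sum) (auto simp del: index_mult_mat_vec)
  ultimately have "(nsq x)\<^sup>2 \<le> c\<^sup>2 * nsq x"
    using assms(1,2) x(1) unfolding op_bound_def
    by (metis carrier_matD(2) norm_of_real power2_abs order_trans)
  then show ?thesis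
    using nsq_nonneg[of x] zero_le_power2[of c] unfolding x(2)[symmetric]
    by (cases "nsq x = 0") (auto simp: power2_eq_square)
qed

lemma op_bound_entry:
  assumes "op_bound c X" "X \<in> carrier_mat n m" "i < n" "j < m"
  shows "cmod (X $$ (i, j)) \<le> c"
proof -
  have "(cmod (X $$ (i, j)))\<^sup>2 \<le> (\<Sum>i<n. (cmod (X $$ (i, j)))\<^sup>2)"
    using assms(3) by (intro member_le_sum) auto
  with op_bound_column[OF assms(1,2,4)] have "(cmod (X $$ (i, j)))\<^sup>2 \<le> c\<^sup>2"
    by linarith
  with assms(1) show ?thesis
    using power2_le_imp_le by (auto simp: op_bound_def)
qed

section \<open>Singular value decomposition\<close>

text \<open>An explicit matrix, rather than a completion to an orthonormal basis, has visibly real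
  entries when v is real; the real factors of the decomposition depend on this.\<close>

lemma exists_unitary_first_column:
  assumes v: "v \<in> carrier_vec n" and v1: "nsq v = 1"
  shows "\<exists>W. unitary n W \<and> W *\<^sub>v unit_vec n 0 = v \<and> ((\<forall>i<n. v $ i \<in> \<real>) \<longrightarrow> real_entries W)"
proof -
  have n: "n > 0"
    using v v1 by (cases n) (auto simp: nsq_def)
  define e where "e = (if v $ 0 = 0 then 1 else sgn (v $ 0))"
  define a where "a = cmod (v $ 0)"
  define b where "b = complex_of_real (1 / (1 + a))"
  define w where "w = (\<lambda>i. v $ i + (if i = 0 then e else 0))"
  define D where "D = (\<lambda>i j :: nat. if i = j then 1 else (0 :: complex))"
  \<comment> \<open>\<open>- e\<close> times the Householder reflection along \<open>v + e * e\<^sub>0\<close>, where \<open>e\<close> is the phase of \<open>v $ 0\<close>;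
    this choice of sign keeps the denominator \<open>1 + a\<close> away from zero.\<close>
  define W where "W = mat n n (\<lambda>(i, j). - e * (D i j - b * w i * cnj (w j)))"
  have a0: "a \<ge> 0" and a1: "1 + complex_of_real a \<noteq> 0"
    by (simp_all add: a_def) (metis norm_ge_zero add_nonneg_eq_0_iff of_real_0 of_real_1 of_real_add of_real_eq_iff zero_le_one zero_neq_one)
  have ee: "cnj e * e = 1"
  proof -
    have "cmod e = 1" by (simp add: e_def norm_sgn)
    then show ?thesis using complex_norm_square[of e] by (simp add: mult.commute)
  qed
  have v0: "v $ 0 = e * a"
    by (auto simp: e_def a_def sgn_div_norm scaleR_conv_of_real)
  have w0: "w 0 = e * (1 + a)"
    by (simp add: w_def v0 algebra_simps)
  have bw0: "b * cnj (w 0) = cnj e"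
    using a1 by (simp add: w0 b_def)
  have bb: "b * (2 + 2 * a) = 2"
    using a1 by (simp add: b_def field_simps)
  have cb: "cnj b = b"
    by (simp add: b_def)
  \<comment> \<open>Only entry 0 of w differs from v, so the squared length is 1 - a^2 + (1 + a)^2.
    Together with \<open>bb\<close> this makes b the Householder factor 2 / |w|^2, for which the
    cross terms in \<open>WW\<close> cancel.\<close>
  have ww: "(\<Sum>l<n. cnj (w l) * w l) = 2 + 2 * a"
  proof -
    obtain n' where n': "n = Suc n'" using n by (cases n) auto
    have "cnj (w 0) * w 0 = (cnj e * e) * (1 + a)\<^sup>2"
      by (simp add: w0 power2_eq_square)
    moreover have "cnj (v $ 0) * v $ 0 = (cnj e * e) * a\<^sup>2"
      by (simp add: v0 power2_eq_square)
    moreover have "(\<Sum>l<n. cnj (v $ l) * v $ l) = 1"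
      using nsq_cscalar[of v] v v1 by simp
    moreover have "(\<Sum>l<n. cnj (v $ l) * v $ l) =
        cnj (v $ 0) * v $ 0 + (\<Sum>l<n'. cnj (v $ Suc l) * v $ Suc l)"
      unfolding n' sum.lessThan_Suc_shift ..
    moreover have "(\<Sum>l<n. cnj (w l) * w l) =
        cnj (w 0) * w 0 + (\<Sum>l<n'. cnj (v $ Suc l) * v $ Suc l)"
      unfolding n' sum.lessThan_Suc_shift by (simp add: w_def)
    ultimately show ?thesis
      unfolding ee by (simp add: power2_eq_square algebra_simps)
  qed
  have WW: "(\<Sum>l<n. cnj (W $$ (l, i)) * W $$ (l, j)) = D i j" if "i < n" "j < n" for i j
  proof -
    have "(\<Sum>l<n. cnj (W $$ (l, i)) * W $$ (l, j)) =
        (\<Sum>l<n. (cnj e * e) * ((D l i * D l j - D l i * (b * w l * cnj (w j)))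
           - D l j * (b * cnj (w l) * w i) + b * b * w i * cnj (w j) * (cnj (w l) * w l)))"
      using that by (intro sum.cong refl) (simp add: W_def cb D_def algebra_simps)
    also have "\<dots> = D i j - b * w i * cnj (w j) - b * cnj (w j) * w i
        + b * b * w i * cnj (w j) * (\<Sum>l<n. cnj (w l) * w l)"
      using that unfolding sum.distrib sum_subtractf ee mult_1 sum_distrib_left
      by (simp add: D_def if_distrib[of "\<lambda>x. x * _"] cong: if_cong)
    also have "\<dots> = D i j - 2 * (b * w i * cnj (w j)) + b * w i * cnj (w j) * (b * (2 + 2 * a))"
      unfolding ww by (simp add: algebra_simps)
    also have "\<dots> = D i j" unfolding bb by simp
    finally show ?thesis .
  qed
  have W: "W \<in> carrier_mat n n" by (simp add: W_def)
  have "mat_adjoint W * W = 1\<^sub>m n"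
  proof (rule eq_matI)
    fix i j assume "i < dim_row (1\<^sub>m n)" "j < dim_col (1\<^sub>m n)"
    then have ij: "i < n" "j < n" by auto
    then have "(mat_adjoint W * W) $$ (i, j) = (\<Sum>l<n. cnj (W $$ (l, i)) * W $$ (l, j))"
      using W by (simp add: mult_index del: index_mult_mat(1))
    then show "(mat_adjoint W * W) $$ (i, j) = 1\<^sub>m n $$ (i, j)"
      using ij by (simp only: WW[OF ij]) (simp add: D_def)
  qed (use W in auto)
  then have "unitary n W"
    unfolding unitary_def
    using W mat_mult_left_right_inverse[OF adj_carrier[OF W] W] by blast
  moreover have "W *\<^sub>v unit_vec n 0 = v"
  proof (rule eq_vecI)
    fix i assume "i < dim_vec v"
    then have i: "i < n" using v by simp
    have "(W *\<^sub>v unit_vec n 0) $ i = - e * (D i 0 - w i * (b * cnj (w 0)))"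
      using i n by (simp add: W_def scalar_prod_right_unit algebra_simps)
    also have "\<dots> = - e * D i 0 + (cnj e * e) * w i"
      unfolding bw0 by (simp add: algebra_simps)
    also have "\<dots> = v $ i" by (simp add: ee D_def w_def)
    finally show "(W *\<^sub>v unit_vec n 0) $ i = v $ i" .
  qed (use v in \<open>simp add: W_def\<close>)
  moreover have "real_entries W" if r: "\<forall>i<n. v $ i \<in> \<real>"
  proof -
    have "e \<in> \<real>"
      using r n by (auto simp: e_def sgn_div_norm scaleR_conv_of_real)
    then have "w i \<in> \<real>" if "i < n" for i
      using r that by (auto simp: w_def)
    then show ?thesis
      using \<open>e \<in> \<real>\<close> by (auto simp: real_entries_def W_def D_def b_def complex_is_Real_iff)
  qed
  ultimately show ?thesis by blast
qed

lemma nsq_smult: "nsq (c \<cdot>\<^sub>v x) = (cmod c)\<^sup>2 * nsq x"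
  by (simp add: nsq_def norm_mult power_mult_distrib sum_distrib_left)

lemma nsq_eq_0_iff: "x \<in> carrier_vec n \<Longrightarrow> nsq x = 0 \<longleftrightarrow> x = 0\<^sub>v n"
  by (auto simp: nsq_def sum_nonneg_eq_0_iff)

text \<open>For an eigenvector x the identity |X x|^2 = \<mu> |x|^2 forces \<mu> to be real and
  nonnegative. If X is real, so are its Gram matrix and \<mu>, hence the real and imaginary parts of
  x satisfy the same equation, and one of them is nonzero.\<close>

lemma gram_eigenvector:
  assumes X: "X \<in> carrier_mat n m" and ev: "eigenvalue (mat_adjoint X * X) \<mu>"
  shows "\<exists>t v. 0 \<le> t \<and> \<mu> = complex_of_real t \<and> v \<in> carrier_vec m \<and> nsq v = 1 \<and>
     (mat_adjoint X * X) *\<^sub>v v = complex_of_real t \<cdot>\<^sub>v v \<and> nsq (X *\<^sub>v v) = t \<and>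
     (real_entries X \<longrightarrow> (\<forall>i<m. v $ i \<in> \<real>))"
proof -
  let ?A = "mat_adjoint X * X"
  have A: "?A \<in> carrier_mat m m" using X by auto
  have nsq_eig: "complex_of_real (nsq (X *\<^sub>v x)) = c * complex_of_real (nsq x)"
    if "x \<in> carrier_vec m" "?A *\<^sub>v x = c \<cdot>\<^sub>v x" for x c
    using that unfolding nsq_mult_adj[OF X that(1)]
    by (simp add: nsq_cscalar sum_distrib_left ac_simps)
  obtain x where x: "x \<in> carrier_vec m" "x \<noteq> 0\<^sub>v m" "?A *\<^sub>v x = \<mu> \<cdot>\<^sub>v x"
    using ev A by (auto simp: eigenvalue_def eigenvector_def)
  define t where "t = nsq (X *\<^sub>v x) / nsq x"
  have nz: "nsq x \<noteq> 0" using x nsq_eq_0_iff by blast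
  have t0: "t \<ge> 0" by (simp add: t_def nsq_nonneg)
  have \<mu>: "\<mu> = complex_of_real t"
    using nsq_eig[OF x(1,3)] nz by (simp add: t_def)
  have "\<exists>y. y \<in> carrier_vec m \<and> y \<noteq> 0\<^sub>v m \<and> ?A *\<^sub>v y = \<mu> \<cdot>\<^sub>v y \<and> (real_entries X \<longrightarrow> (\<forall>i<m. y $ i \<in> \<real>))"
  proof (cases "real_entries X")
    case True
    then have rA: "real_entries ?A"
      using X by (intro real_entries_mult real_entries_adj) auto
    have Aij: "complex_of_real (Re (?A $$ (i, j))) = ?A $$ (i, j)" if "i < m" "j < m" for i j
      using rA that A unfolding real_entries_def by (auto simp: of_real_Re simp del: index_mult_mat(1))
    define xr where "xr = vec m (\<lambda>i. complex_of_real (Re (x $ i)))"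
    define xi where "xi = vec m (\<lambda>i. complex_of_real (Im (x $ i)))"
    have Im0: "Im (?A $$ (i, j)) = 0" if "i < m" "j < m" for i j
      using Aij[OF that] by (metis Im_complex_of_real)
    have "?A *\<^sub>v xr = \<mu> \<cdot>\<^sub>v xr"
    proof (rule eq_vecI)
      fix i assume "i < dim_vec (\<mu> \<cdot>\<^sub>v xr)"
      then have i: "i < m" by (simp add: xr_def)
      have "(?A *\<^sub>v xr) $ i = (\<Sum>j<m. ?A $$ (i, j) * complex_of_real (Re (x $ j)))"
        using i A X by (simp add: mult_vec_index xr_def del: index_mult_mat index_mult_mat_vec)
      also have "\<dots> = complex_of_real (Re (\<Sum>j<m. ?A $$ (i, j) * x $ j))"
        using i by (intro complex_eqI) (simp_all add: Im0 del: index_mult_mat)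
      also have "(\<Sum>j<m. ?A $$ (i, j) * x $ j) = \<mu> * x $ i"
        using arg_cong[OF x(3), of "\<lambda>z. z $ i"] i x(1) A X
        by (simp add: mult_vec_index del: index_mult_mat index_mult_mat_vec)
      finally show "(?A *\<^sub>v xr) $ i = (\<mu> \<cdot>\<^sub>v xr) $ i"
        using i by (simp add: xr_def \<mu>)
    qed (use X in \<open>simp add: xr_def\<close>)
    moreover have "?A *\<^sub>v xi = \<mu> \<cdot>\<^sub>v xi"
    proof (rule eq_vecI)
      fix i assume "i < dim_vec (\<mu> \<cdot>\<^sub>v xi)"
      then have i: "i < m" by (simp add: xi_def)
      have "(?A *\<^sub>v xi) $ i = (\<Sum>j<m. ?A $$ (i, j) * complex_of_real (Im (x $ j)))"
        using i A X by (simp add: mult_vec_index xi_def del: index_mult_mat index_mult_mat_vec)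
      also have "\<dots> = complex_of_real (Im (\<Sum>j<m. ?A $$ (i, j) * x $ j))"
        using i by (intro complex_eqI) (simp_all add: Im0 del: index_mult_mat)
      also have "(\<Sum>j<m. ?A $$ (i, j) * x $ j) = \<mu> * x $ i"
        using arg_cong[OF x(3), of "\<lambda>z. z $ i"] i x(1) A X
        by (simp add: mult_vec_index del: index_mult_mat index_mult_mat_vec)
      finally show "(?A *\<^sub>v xi) $ i = (\<mu> \<cdot>\<^sub>v xi) $ i"
        using i by (simp add: xi_def \<mu>)
    qed (use X in \<open>simp add: xi_def\<close>)
    moreover have "xr \<noteq> 0\<^sub>v m \<or> xi \<noteq> 0\<^sub>v m"
    proof (rule ccontr)
      assume "\<not> ?thesis"
      then have "Re (x $ i) = 0 \<and> Im (x $ i) = 0" if "i < m" for i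
        using that by (metis index_vec index_zero_vec(1) of_real_eq_0_iff xr_def xi_def)
      then have "x = 0\<^sub>v m"
        using x(1) by (intro eq_vecI) (auto simp: complex_eq_iff)
      with x(2) show False by simp
    qed
    ultimately show ?thesis
      unfolding xr_def xi_def
      by (metis (no_types, lifting) Reals_of_real index_vec vec_carrier)
  qed (use x in blast)
  then obtain y where y: "y \<in> carrier_vec m" "y \<noteq> 0\<^sub>v m" "?A *\<^sub>v y = \<mu> \<cdot>\<^sub>v y"
    "real_entries X \<longrightarrow> (\<forall>i<m. y $ i \<in> \<real>)"
    by blast
  define c where "c = complex_of_real (1 / sqrt (nsq y))"
  define v where "v = c \<cdot>\<^sub>v y"
  have ny: "nsq y > 0"
    using y(1,2) nsq_eq_0_iff nsq_nonneg by (metis less_eq_real_def)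
  have v: "v \<in> carrier_vec m" using y by (simp add: v_def)
  have v1: "nsq v = 1"
    using ny by (simp add: v_def nsq_smult c_def norm_divide power_divide)
  have Av: "?A *\<^sub>v v = complex_of_real t \<cdot>\<^sub>v v"
    using y(3) mult_mat_vec[OF A y(1)] by (simp add: v_def \<mu> smult_smult_assoc mult.commute)
  have "complex_of_real (nsq (X *\<^sub>v v)) = complex_of_real t"
    using nsq_eig[OF v Av] v1 by simp
  then have "nsq (X *\<^sub>v v) = t" using of_real_eq_iff by blast
  moreover have "real_entries X \<longrightarrow> (\<forall>i<m. v $ i \<in> \<real>)"
    using y by (auto simp: v_def c_def)
  ultimately show ?thesis using t0 \<mu> v v1 Av by blast
qed


section \<open>Uniqueness of the singular values\<close>

lemma rdiag_carrier [simp]: "rdiag n m s \<in> carrier_mat n m"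
  by (simp add: rdiag_def)

lemma rdiag_dim [simp]: "dim_row (rdiag n m s) = n" "dim_col (rdiag n m s) = m"
  by (simp_all add: rdiag_def)

text \<open>The Gram matrix is unitarily similar to that of the diagonal factor. If n < m, the
  columns of the diagonal factor from n on are zero and give the default eigenvalue 0.\<close>

lemma char_poly_gram_svd:
  assumes U: "unitary n U" and V: "unitary m V"
  shows "char_poly (mat_adjoint (U * rdiag n m s * mat_adjoint V) * (U * rdiag n m s * mat_adjoint V)) =
    (\<Prod>i\<leftarrow>[0..<m]. [:- complex_of_real (if i < n then (s $ i)\<^sup>2 else 0), 1:])"
proof -
  let ?S = "rdiag n m s"
  let ?X = "U * ?S * mat_adjoint V"
  let ?d = "\<lambda>i. complex_of_real (if i < n then (s $ i)\<^sup>2 else 0)"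
  define M where "M = mat_adjoint ?S * ?S"
  have c: "U \<in> carrier_mat n n" "V \<in> carrier_mat m m" "M \<in> carrier_mat m m"
    "mat_adjoint U * U = 1\<^sub>m n"
    using U V by (auto simp: M_def unitary_def)
  have M: "M $$ (i, j) = (if i = j then ?d i else 0)" if "i < m" "j < m" for i j
    using that by (auto simp: M_def mult_index rdiag_def power2_eq_square if_distrib[of "\<lambda>x. x * _"]
        if_distrib[of cnj] simp del: index_mult_mat(1) cong: if_cong)
  have "mat_adjoint ?X = V * (mat_adjoint ?S * mat_adjoint U)"
    using c by (simp add: adj_mult[of _ n m _ m] adj_mult[of _ n n _ m])
  then have "mat_adjoint ?X * ?X = V * (mat_adjoint ?S * ((mat_adjoint U * U) * (?S * mat_adjoint V)))"
    using c(1,2) by (simp add: mult_assoc_dim)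
  also have "\<dots> = V * M * mat_adjoint V"
    using c by (simp add: mult_assoc_dim M_def left_mult_one_mat[of _ n m] mult_carrier_mat[of _ n m])
  finally have "similar_mat (mat_adjoint ?X * ?X) M"
    using c V by (intro similar_matI[of _ _ V "mat_adjoint V" m]) (auto simp: unitary_def)
  then have "char_poly (mat_adjoint ?X * ?X) = char_poly M"
    by (rule char_poly_similar)
  also have "\<dots> = (\<Prod>a\<leftarrow>diag_mat M. [:- a, 1:])"
    using c(3) M by (intro char_poly_upper_triangular[of _ m]) auto
  also have "diag_mat M = map ?d [0..<m]"
    using c(3) M by (auto simp: diag_mat_def)
  finally show ?thesis by (simp add: comp_def)
qed

lemma proots_linear_factors: "proots (\<Prod>a\<leftarrow>xs. [:- a, 1:]) = mset xs"
  for xs :: "'a :: field list"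
proof (induction xs)
  case (Cons a xs)
  have "(\<Prod>a\<leftarrow>xs. [:- a, 1:]) \<noteq> 0"
    by (auto simp: prod_list_zero_iff)
  then show ?case
    using Cons proots_mult[of "[:- a, 1:]" "\<Prod>a\<leftarrow>xs. [:- a, 1:]"] by (simp del: mult_pCons_left)
qed simp

text \<open>The squared values, padded with zeros, are the roots with multiplicity of a polynomial
  that depends on X only. Two sorted lists with the same multiset agree, and nonnegativity recovers
  the values from their squares.\<close>

lemma is_svd_unique:
  assumes "is_svd X U s V" "is_svd X U' s' V'"
  shows "s = s'"
proof -
  define n where "n = dim_row X"
  define m where "m = dim_col X"
  define d where "d = (\<lambda>s :: real vec. map (\<lambda>i. if i < n then (s $ i)\<^sup>2 else 0) [0..<m])"
  have proots: "image_mset complex_of_real (mset (d t)) = proots (char_poly (mat_adjoint X * X))"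
    if "is_svd X W t Z" for W t Z
  proof -
    have W: "unitary n W" "unitary m Z" and X: "X = W * rdiag n m t * mat_adjoint Z"
      using that by (simp_all add: is_svd_def n_def m_def)
    show ?thesis
      unfolding X char_poly_gram_svd[OF W] d_def
      using proots_linear_factors[of "map (\<lambda>i. complex_of_real (if i < n then (t $ i)\<^sup>2 else 0)) [0..<m]"]
      by (simp add: comp_def multiset.map_comp del: mset_upt)
  qed
  have sorted: "sorted (rev (d t))" if "is_svd X W t Z" for W t Z
  proof -
    have t: "dim_vec t = min n m" "\<And>i. i < min n m \<Longrightarrow> 0 \<le> t $ i"
      "\<And>i j. i \<le> j \<Longrightarrow> j < min n m \<Longrightarrow> t $ j \<le> t $ i"
      using that by (auto simp: is_svd_def n_def m_def)
    show ?thesis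
      unfolding sorted_wrt_rev sorted_wrt_iff_nth_less[of _ "d t"]
    proof (intro allI impI)
      fix i j assume ij: "i < j" "j < length (d t)"
      then have "i < m" "j < m" by (auto simp: d_def)
      then show "d t ! j \<le> d t ! i"
        using ij(1) t(2)[of j] t(3)[of i j] by (auto simp: d_def intro: power_mono)
    qed
  qed
  have "image_mset complex_of_real (mset (d s)) = image_mset complex_of_real (mset (d s'))"
    unfolding proots[OF assms(1)] proots[OF assms(2)] ..
  then have "mset (d s) = mset (d s')"
    by (rule injD[OF multiset.inj_map[OF inj_of_real]])
  then have "sort (rev (d s')) = rev (d s)"
    by (intro properties_for_sort sorted[OF assms(1)]) simp
  moreover have "sort (rev (d s')) = rev (d s')"
    by (intro properties_for_sort sorted[OF assms(2)] refl)
  ultimately have "d s = d s'" by simp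
  then have eq: "d s ! i = d s' ! i" for i by simp
  show ?thesis
  proof (rule eq_vecI)
    show "dim_vec s = dim_vec s'" using assms by (simp add: is_svd_def)
    fix i assume "i < dim_vec s'"
    then have i: "i < n" "i < m" "s $ i \<ge> 0" "s' $ i \<ge> 0"
      using assms by (auto simp: is_svd_def n_def m_def)
    then have "(s $ i)\<^sup>2 = (s' $ i)\<^sup>2"
      using eq[of i] by (simp add: d_def)
    with i show "s $ i = s' $ i" by (simp add: power2_eq_iff_nonneg)
  qed
qed

text \<open>One deflation step of the decomposition. Maximality of \<sigma> is expressed through
  eigenvalues of the Gram matrix because that can be compared with the characteristic polynomial of
  the finished factorisation.\<close>

lemma top_singular_pair:
  assumes X: "X \<in> carrier_mat n m" and n: "n > 0" and m: "m > 0"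
  shows "\<exists>\<sigma> u v. 0 \<le> \<sigma> \<and> u \<in> carrier_vec n \<and> v \<in> carrier_vec m \<and> nsq u = 1 \<and> nsq v = 1 \<and>
     X *\<^sub>v v = complex_of_real \<sigma> \<cdot>\<^sub>v u \<and> mat_adjoint X *\<^sub>v u = complex_of_real \<sigma> \<cdot>\<^sub>v v \<and>
     (\<forall>t. eigenvalue (mat_adjoint X * X) (complex_of_real t) \<longrightarrow> t \<le> \<sigma>\<^sup>2) \<and>
     (real_entries X \<longrightarrow> (\<forall>i<n. u $ i \<in> \<real>) \<and> (\<forall>i<m. v $ i \<in> \<real>))"
proof -
  let ?A = "mat_adjoint X * X"
  have A: "?A \<in> carrier_mat m m" and A': "X * mat_adjoint X \<in> carrier_mat n n"
    and X': "mat_adjoint X \<in> carrier_mat m n"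
    using X by auto
  have "\<exists>\<mu>\<in>spectrum ?A. \<forall>\<mu>'\<in>spectrum ?A. Re \<mu>' \<le> Re \<mu>"
    using obtains_MAX[OF card_finite_spectrum(1)[OF A] spectrum_non_empty[OF A m], of Re]
      Max_ge[OF finite_imageI[OF card_finite_spectrum(1)[OF A]]] by (metis imageI)
  then obtain \<mu> where \<mu>: "eigenvalue ?A \<mu>" and \<mu>_max: "\<And>\<mu>'. eigenvalue ?A \<mu>' \<Longrightarrow> Re \<mu>' \<le> Re \<mu>"
    by (auto simp: spectrum_def)
  obtain t v where t: "0 \<le> t" "\<mu> = complex_of_real t" and v: "v \<in> carrier_vec m" "nsq v = 1"
    and Av: "?A *\<^sub>v v = complex_of_real t \<cdot>\<^sub>v v" and Xv: "nsq (X *\<^sub>v v) = t"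
    and vr: "real_entries X \<longrightarrow> (\<forall>i<m. v $ i \<in> \<real>)"
    using gram_eigenvector[OF X \<mu>] by blast
  have t_max: "t' \<le> t" if "eigenvalue ?A (complex_of_real t')" for t'
    using \<mu>_max[OF that] t by simp
  have Xvc: "X *\<^sub>v v \<in> carrier_vec n" using X v by auto
  show ?thesis
  proof (cases "t = 0")
    case False
    \<comment> \<open>Normalising X v is the only choice for u; the eigenvalue equation then gives
      the adjoint relation with t / sqrt t = sqrt t.\<close>
    define u where "u = complex_of_real (1 / sqrt t) \<cdot>\<^sub>v (X *\<^sub>v v)"
    have tpos: "t > 0" using False t by simp
    have u: "u \<in> carrier_vec n" "nsq u = 1"
      using Xvc tpos by (auto simp: u_def nsq_smult Xv norm_divide power_divide)
    have Xv': "X *\<^sub>v v = complex_of_real (sqrt t) \<cdot>\<^sub>v u"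
      using tpos by (simp add: u_def smult_smult_assoc flip: of_real_mult)
    have "mat_adjoint X *\<^sub>v u = complex_of_real (1 / sqrt t) \<cdot>\<^sub>v (?A *\<^sub>v v)"
      unfolding u_def using mult_mat_vec[OF X' Xvc] assoc_mult_mat_vec[OF X' X v(1)] by simp
    also have "\<dots> = complex_of_real (sqrt t) \<cdot>\<^sub>v v"
      unfolding Av using tpos
      by (simp add: smult_smult_assoc real_div_sqrt flip: of_real_mult del: of_real_divide)
    finally have "mat_adjoint X *\<^sub>v u = complex_of_real (sqrt t) \<cdot>\<^sub>v v" .
    moreover have "real_entries X \<longrightarrow> (\<forall>i<n. u $ i \<in> \<real>)"
      using vr X v(1) unfolding u_def real_entries_def
      by (auto simp: mult_vec_index simp del: index_mult_mat_vec intro!: Reals_divide Reals_mult sum_in_Reals)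
    ultimately show ?thesis
      using u v Xv' vr t_max tpos by (intro exI[of _ "sqrt t"] exI[of _ u] exI[of _ v]) auto
  next
    \<comment> \<open>Here \<open>u\<close> has to be taken from the kernel of \<open>mat_adjoint X\<close>, which is nontrivial because
      every nonzero eigenvalue of \<open>X * mat_adjoint X\<close> is one of \<open>mat_adjoint X * X\<close>.\<close>
    case True
    have "spectrum (X * mat_adjoint X) \<noteq> {}"
      by (rule spectrum_non_empty[OF A' n])
    then obtain \<mu>' where \<mu>': "eigenvalue (mat_adjoint (mat_adjoint X) * mat_adjoint X) \<mu>'"
      by (auto simp: spectrum_def)
    obtain t' u where t': "0 \<le> t'" and u: "u \<in> carrier_vec n" "nsq u = 1"
      and Au: "(X * mat_adjoint X) *\<^sub>v u = complex_of_real t' \<cdot>\<^sub>v u"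
      and Xu: "nsq (mat_adjoint X *\<^sub>v u) = t'"
      and ur: "real_entries X \<longrightarrow> (\<forall>i<n. u $ i \<in> \<real>)"
      using gram_eigenvector[OF X' \<mu>'] real_entries_adj[of X] by auto
    have Xuc: "mat_adjoint X *\<^sub>v u \<in> carrier_vec m" using X' u by auto
    have "t' = 0"
    proof (rule ccontr)
      assume "t' \<noteq> 0"
      then have "mat_adjoint X *\<^sub>v u \<noteq> 0\<^sub>v m"
        using Xu nsq_eq_0_iff[OF Xuc] by simp
      moreover have "?A *\<^sub>v (mat_adjoint X *\<^sub>v u) = complex_of_real t' \<cdot>\<^sub>v (mat_adjoint X *\<^sub>v u)"
      proof -
        have "?A *\<^sub>v (mat_adjoint X *\<^sub>v u) = mat_adjoint X *\<^sub>v ((X * mat_adjoint X) *\<^sub>v u)"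
          using assoc_mult_mat_vec[OF X' X Xuc] assoc_mult_mat_vec[OF X X' u(1)] by simp
        then show ?thesis unfolding Au using mult_mat_vec[OF X' u(1)] by simp
      qed
      ultimately have "eigenvalue ?A (complex_of_real t')"
        unfolding eigenvalue_def eigenvector_def using Xuc X by auto
      then show False using t_max[of t'] t' \<open>t' \<noteq> 0\<close> True by simp
    qed
    then have "mat_adjoint X *\<^sub>v u = 0\<^sub>v m" "X *\<^sub>v v = 0\<^sub>v n"
      using Xu Xv True nsq_eq_0_iff[OF Xuc] nsq_eq_0_iff[OF Xvc] by auto
    then show ?thesis
      using u v vr ur t_max True by (intro exI[of _ 0] exI[of _ u] exI[of _ v]) auto
  qed
qed

section \<open>Deflation and existence of the decomposition\<close>

definition bordered :: "complex \<Rightarrow> complex mat \<Rightarrow> complex mat" where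
  "bordered c A = mat (Suc (dim_row A)) (Suc (dim_col A))
     (\<lambda>(i, j). if i = 0 \<and> j = 0 then c else if i = 0 \<or> j = 0 then 0 else A $$ (i - 1, j - 1))"

lemma bordered_carrier [simp]: "A \<in> carrier_mat n m \<Longrightarrow> bordered c A \<in> carrier_mat (Suc n) (Suc m)"
  by (auto simp: bordered_def)

lemma bordered_mult:
  assumes "A \<in> carrier_mat n p" "B \<in> carrier_mat p m"
  shows "bordered c A * bordered d B = bordered (c * d) (A * B)"
proof (rule eq_matI)
  fix i j assume "i < dim_row (bordered (c * d) (A * B))" "j < dim_col (bordered (c * d) (A * B))"
  then have ij: "i < Suc n" "j < Suc m" using assms by (auto simp: bordered_def)
  then have "(bordered c A * bordered d B) $$ (i, j) =
      (\<Sum>l<Suc p. bordered c A $$ (i, l) * bordered d B $$ (l, j))"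
    using assms by (simp add: mult_index bordered_def del: index_mult_mat(1) sum.lessThan_Suc)
  also have "\<dots> = bordered (c * d) (A * B) $$ (i, j)"
    using ij assms unfolding sum.lessThan_Suc_shift
    by (cases i; cases j) (auto simp: bordered_def mult_index simp del: index_mult_mat(1))
  finally show "(bordered c A * bordered d B) $$ (i, j) = bordered (c * d) (A * B) $$ (i, j)" .
qed (use assms in \<open>auto simp: bordered_def\<close>)

lemma bordered_adj: "mat_adjoint (bordered c A) = bordered (cnj c) (mat_adjoint A)"
  by (rule eq_matI) (auto simp: bordered_def)

lemma unitary_bordered:
  assumes "unitary n U"
  shows "unitary (Suc n) (bordered 1 U)"
proof -
  have "bordered 1 (1\<^sub>m n) = 1\<^sub>m (Suc n)"
    by (rule eq_matI) (auto simp: bordered_def)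
  then show ?thesis
    using assms by (simp add: unitary_def bordered_adj bordered_mult[of _ n n _ n])
qed

lemma rdiag_vCons: "rdiag (Suc n) (Suc m) (vCons t s) = bordered (complex_of_real t) (rdiag n m s)"
proof (rule eq_matI)
  fix i j assume "i < dim_row (bordered (complex_of_real t) (rdiag n m s))"
    "j < dim_col (bordered (complex_of_real t) (rdiag n m s))"
  then show "rdiag (Suc n) (Suc m) (vCons t s) $$ (i, j) = bordered (complex_of_real t) (rdiag n m s) $$ (i, j)"
    by (cases i; cases j) (auto simp: rdiag_def bordered_def)
qed (auto simp: bordered_def)

text \<open>In bases that start with a top singular pair, the first column and the first row of X
  vanish off the diagonal, so the remaining block is smaller in both directions. Hence the induction
  on n with m arbitrary.\<close>

theorem svd_exists:
  assumes "X \<in> carrier_mat n m"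
  shows "\<exists>U s V. is_svd X U s V \<and> (real_entries X \<longrightarrow> real_entries U \<and> real_entries V)"
  using assms
proof (induction n arbitrary: m X)
  case 0
  have "X = 1\<^sub>m 0 * rdiag 0 m (vec 0 (\<lambda>_. 0)) * mat_adjoint (1\<^sub>m m)"
    using 0 by (intro eq_matI) auto
  then have "is_svd X (1\<^sub>m 0) (vec 0 (\<lambda>_. 0)) (1\<^sub>m m)"
    using 0 by (auto simp: is_svd_def unitary_one)
  then show ?case using real_entries_one by blast
next
  case (Suc n)
  show ?case
  proof (cases m)
    case 0
    have "X = 1\<^sub>m (Suc n) * rdiag (Suc n) 0 (vec 0 (\<lambda>_. 0)) * mat_adjoint (1\<^sub>m 0)"
      using Suc.prems 0 by (intro eq_matI) auto
    then have "is_svd X (1\<^sub>m (Suc n)) (vec 0 (\<lambda>_. 0)) (1\<^sub>m 0)"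
      using Suc.prems 0 by (auto simp: is_svd_def unitary_one)
    then show ?thesis using real_entries_one by blast
  next
    case (Suc m')
    have X: "X \<in> carrier_mat (Suc n) (Suc m')" using Suc.prems Suc by simp
    have X': "mat_adjoint X \<in> carrier_mat (Suc m') (Suc n)" using X by simp
    obtain \<sigma> u v where \<sigma>: "0 \<le> \<sigma>" and u: "u \<in> carrier_vec (Suc n)" "nsq u = 1"
      and v: "v \<in> carrier_vec (Suc m')" "nsq v = 1"
      and Xv: "X *\<^sub>v v = complex_of_real \<sigma> \<cdot>\<^sub>v u" and Xu: "mat_adjoint X *\<^sub>v u = complex_of_real \<sigma> \<cdot>\<^sub>v v"
      and smax: "\<And>t. eigenvalue (mat_adjoint X * X) (complex_of_real t) \<Longrightarrow> t \<le> \<sigma>\<^sup>2"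
      and real_uv: "real_entries X \<longrightarrow> (\<forall>i<Suc n. u $ i \<in> \<real>) \<and> (\<forall>i<Suc m'. v $ i \<in> \<real>)"
      using top_singular_pair[OF X zero_less_Suc zero_less_Suc] by blast
    obtain U1 where U1: "unitary (Suc n) U1" "U1 *\<^sub>v unit_vec (Suc n) 0 = u"
      "(\<forall>i<Suc n. u $ i \<in> \<real>) \<longrightarrow> real_entries U1"
      using exists_unitary_first_column[OF u] by blast
    obtain V1 where V1: "unitary (Suc m') V1" "V1 *\<^sub>v unit_vec (Suc m') 0 = v"
      "(\<forall>i<Suc m'. v $ i \<in> \<real>) \<longrightarrow> real_entries V1"
      using exists_unitary_first_column[OF v] by blast
    have U1c: "U1 \<in> carrier_mat (Suc n) (Suc n)" and V1c: "V1 \<in> carrier_mat (Suc m') (Suc m')"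
      using U1 V1 by auto
    define Y where "Y = mat_adjoint U1 * X * V1"
    have Y: "Y \<in> carrier_mat (Suc n) (Suc m')" using U1c V1c X by (auto simp: Y_def)
    define Z where "Z = mat n m' (\<lambda>(i, j). Y $$ (Suc i, Suc j))"
    have Z: "Z \<in> carrier_mat n m'" by (simp add: Z_def)
    have unit_back: "mat_adjoint W *\<^sub>v w = unit_vec k 0"
      if "unitary k W" "W *\<^sub>v unit_vec k 0 = w" for k W w
    proof -
      have "(mat_adjoint W * W) *\<^sub>v unit_vec k 0 = mat_adjoint W *\<^sub>v w"
        using unitary_carrier[OF that(1)] that(2) by (simp add: assoc_mult_mat_vec[of _ k k _ k])
      then show ?thesis using that(1) by (simp add: unitary_def)
    qed
    have "Y *\<^sub>v unit_vec (Suc m') 0 = mat_adjoint U1 *\<^sub>v (X *\<^sub>v v)"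
      unfolding Y_def V1(2)[symmetric] using U1c V1c X
      by (simp add: mult_vec_assoc_dim)
    also have "\<dots> = complex_of_real \<sigma> \<cdot>\<^sub>v unit_vec (Suc n) 0"
      unfolding Xv unit_back[OF U1(1,2), symmetric] using U1c u by (simp add: mult_mat_vec[of _ "Suc n" "Suc n"])
    finally have col_eq: "Y *\<^sub>v unit_vec (Suc m') 0 = complex_of_real \<sigma> \<cdot>\<^sub>v unit_vec (Suc n) 0" .
    have col0: "Y $$ (i, 0) = (if i = 0 then complex_of_real \<sigma> else 0)" if "i < Suc n" for i
      using arg_cong[OF col_eq, of "\<lambda>x. x $ i"] that Y by (simp add: scalar_prod_right_unit)
    \<comment> \<open>The first row of Y is read off as the first column of its adjoint; this is
      where the second equation of the singular pair is used.\<close>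
    have "mat_adjoint Y *\<^sub>v unit_vec (Suc n) 0 = mat_adjoint V1 *\<^sub>v (mat_adjoint X *\<^sub>v u)"
      unfolding Y_def U1(2)[symmetric] using U1c V1c X
      by (simp add: adj_mult_dim mult_vec_assoc_dim)
    also have "\<dots> = complex_of_real \<sigma> \<cdot>\<^sub>v unit_vec (Suc m') 0"
      unfolding Xu unit_back[OF V1(1,2), symmetric] using V1c v by (simp add: mult_mat_vec[of _ "Suc m'" "Suc m'"])
    finally have row_eq: "mat_adjoint Y *\<^sub>v unit_vec (Suc n) 0 = complex_of_real \<sigma> \<cdot>\<^sub>v unit_vec (Suc m') 0" .
    have row0: "Y $$ (0, j) = (if j = 0 then complex_of_real \<sigma> else 0)" if "j < Suc m'" for j
      using arg_cong[OF row_eq, of "\<lambda>x. cnj (x $ j)"] that Y by (simp add: scalar_prod_right_unit)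
    have YZ: "Y = bordered (complex_of_real \<sigma>) Z"
      using Y col0 row0 by (intro eq_matI) (auto simp: bordered_def Z_def)
    obtain U2 s V2 where svd: "is_svd Z U2 s V2" and real_UV2: "real_entries Z \<longrightarrow> real_entries U2 \<and> real_entries V2"
      using Suc.IH[OF Z] by blast
    have U2: "unitary n U2" and V2: "unitary m' V2" and s: "dim_vec s = min n m'"
      "\<And>i. i < dim_vec s \<Longrightarrow> 0 \<le> s $ i"
      "\<And>i j. i \<le> j \<Longrightarrow> j < dim_vec s \<Longrightarrow> s $ j \<le> s $ i" and Zd: "Z = U2 * rdiag n m' s * mat_adjoint V2"
      using svd Z by (auto simp: is_svd_def)
    have U2c: "U2 \<in> carrier_mat n n" and V2c: "V2 \<in> carrier_mat m' m'" using U2 V2 by auto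
    define U where "U = U1 * bordered 1 U2"
    define V where "V = V1 * bordered 1 V2"
    define t where "t = vCons \<sigma> s"
    have U: "unitary (Suc n) U" and V: "unitary (Suc m') V"
      unfolding U_def V_def using unitary_mult U1(1) V1(1) unitary_bordered U2 V2 by auto
    have "U * rdiag (Suc n) (Suc m') t * mat_adjoint V =
        U1 * (bordered 1 U2 * rdiag (Suc n) (Suc m') t * mat_adjoint (bordered 1 V2)) * mat_adjoint V1"
    proof -
      have "bordered 1 U2 \<in> carrier_mat (Suc n) (Suc n)" "bordered 1 V2 \<in> carrier_mat (Suc m') (Suc m')"
        using U2c V2c by auto
      then show ?thesis
        unfolding U_def V_def using U1c V1c
        by (simp add: adj_mult_dim mult_assoc_dim)
    qed
    also have "bordered 1 U2 * rdiag (Suc n) (Suc m') t * mat_adjoint (bordered 1 V2) = Y"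
      unfolding t_def rdiag_vCons YZ Zd bordered_adj using U2c V2c
      by (simp add: bordered_mult[of _ n n _ m'] bordered_mult[of _ n m' _ m'])
    also have "U1 * Y * mat_adjoint V1 = X"
      unfolding Y_def using unitary_cancel(2)[OF U1(1) V1(1) X] .
    finally have Xd: "X = U * rdiag (Suc n) (Suc m') t * mat_adjoint V" ..
    \<comment> \<open>The largest value of the block stands at position 1 of \<open>t\<close>, so
      its square is a root of the characteristic polynomial of the Gram matrix of X, and the
      maximality of \<sigma> applies. A nonempty \<open>s\<close> guarantees that position 1 exists
      in both directions.\<close>
    have top: "s $ 0 \<le> \<sigma>" if "0 < dim_vec s"
    proof -
      have "[:- complex_of_real ((s $ 0)\<^sup>2), 1:] dvd char_poly (mat_adjoint X * X)"
        unfolding Xd char_poly_gram_svd[OF U V]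
      proof (rule prod_list_dvd, unfold set_map, rule image_eqI[where x = 1])
        show "1 \<in> set [0..<Suc m']" using that s(1) by (simp del: upt_Suc)
      qed (use that s(1) in \<open>simp add: t_def\<close>)
      then have "eigenvalue (mat_adjoint X * X) (complex_of_real ((s $ 0)\<^sup>2))"
        using X by (subst eigenvalue_root_char_poly[of _ "Suc m'"]) (auto simp: poly_eq_0_iff_dvd)
      from smax[OF this] show ?thesis using \<sigma> by (rule power2_le_imp_le)
    qed
    have "is_svd X U t V"
      unfolding is_svd_def
    proof (intro conjI allI impI)
      show "unitary (dim_row X) U" "unitary (dim_col X) V" using U V X by auto
      show "dim_vec t = min (dim_row X) (dim_col X)" using s X by (simp add: t_def)
      show "X = U * rdiag (dim_row X) (dim_col X) t * mat_adjoint V"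
        unfolding carrier_matD[OF X] by (rule Xd)
      show "0 \<le> t $ i" if "i < dim_vec t" for i
        using that s \<sigma> by (cases i) (auto simp: t_def)
      show "t $ j \<le> t $ i" if "i \<le> j" "j < dim_vec t" for i j
      proof (cases i)
        case i0: 0
        show ?thesis
        proof (cases j)
          case (Suc j')
          then have "s $ j' \<le> s $ 0" "0 < dim_vec s" using that s(3)[of 0 j'] by (auto simp: t_def)
          then show ?thesis using top Suc i0 by (simp add: t_def)
        qed (simp add: i0)
      next
        case (Suc i')
        then show ?thesis using that s(3)[of i' "j - 1"] by (cases j) (auto simp: t_def)
      qed
    qed
    moreover have "real_entries U \<and> real_entries V" if r: "real_entries X"
    proof -
      have U1r: "real_entries U1" and V1r: "real_entries V1" using r real_uv U1(3) V1(3) by auto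
      then have "real_entries Y"
        unfolding Y_def using r U1c V1c X by (intro real_entries_mult real_entries_adj) auto
      then have "real_entries Z" using Y by (auto simp: real_entries_def Z_def)
      then have "real_entries (bordered 1 U2)" "real_entries (bordered 1 V2)"
        using real_UV2 U2c V2c by (auto simp: real_entries_def bordered_def)
      then show ?thesis
        unfolding U_def V_def using U1r V1r U1c V1c U2c V2c
        by (intro conjI real_entries_mult) (auto simp: bordered_def)
    qed
    ultimately show ?thesis by blast
  qed
qed

section \<open>Spectral and nuclear norm duality\<close>

lemma sing_vals_eq: "is_svd X U s V \<Longrightarrow> sing_vals X = s"
  unfolding sing_vals_def using is_svd_unique by blast

lemma svd_of:
  assumes "X \<in> carrier_mat n m"
  obtains U V where "unitary n U" "unitary m V" "X = U * rdiag n m (sing_vals X) * mat_adjoint V"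
    "is_svd X U (sing_vals X) V" "real_entries X \<Longrightarrow> real_entries U \<and> real_entries V"
proof -
  obtain U s V where svd: "is_svd X U s V" "real_entries X \<longrightarrow> real_entries U \<and> real_entries V"
    using svd_exists[OF assms] by blast
  from svd(1) have "unitary (dim_row X) U" "unitary (dim_col X) V"
    "X = U * rdiag (dim_row X) (dim_col X) s * mat_adjoint V"
    by (auto simp only: is_svd_def)
  then show thesis
    using svd unfolding carrier_matD[OF assms] sing_vals_eq[OF svd(1), symmetric]
    by (intro that) auto
qed

lemma sing_vals_props:
  assumes "X \<in> carrier_mat n m"
  shows "dim_vec (sing_vals X) = min n m" "i < min n m \<Longrightarrow> 0 \<le> sing_vals X $ i"
proof -
  obtain U V where "is_svd X U (sing_vals X) V"
    using svd_of[OF assms] by metis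
  then show "dim_vec (sing_vals X) = min n m" "i < min n m \<Longrightarrow> 0 \<le> sing_vals X $ i"
    unfolding is_svd_def carrier_matD[OF assms] by auto
qed

lemma minner_rdiag:
  assumes "X \<in> carrier_mat n m"
  shows "minner (rdiag n m s) X = (\<Sum>i<min n m. s $ i * Re (X $$ (i, i)))"
proof -
  have "minner (rdiag n m s) X = (\<Sum>i<n. \<Sum>j<m. if i = j then s $ i * Re (X $$ (i, i)) else 0)"
    unfolding minner_entries[OF rdiag_carrier assms]
    by (intro sum.cong refl) (auto simp: rdiag_def)
  also have "\<dots> = (\<Sum>i<n. if i < m then s $ i * Re (X $$ (i, i)) else 0)"
    by (intro sum.cong refl) (simp add: sum.delta)
  also have "\<dots> = (\<Sum>i<min n m. s $ i * Re (X $$ (i, i)))"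
    by (intro sum.mono_neutral_cong_right) auto
  finally show ?thesis .
qed

lemma op_bound_rdiag:
  assumes "0 \<le> c" "\<And>i. i < min n m \<Longrightarrow> \<bar>s $ i\<bar> \<le> c"
  shows "op_bound c (rdiag n m s)"
proof -
  have "nsq (rdiag n m s *\<^sub>v x) \<le> c\<^sup>2 * nsq x" if x: "x \<in> carrier_vec m" for x
  proof -
    have entry: "(rdiag n m s *\<^sub>v x) $ i = (if i < m then complex_of_real (s $ i) * x $ i else 0)" if "i < n" for i
      using that x by (simp add: mult_vec_index rdiag_def if_distrib[of "\<lambda>z. z * _"] del: index_mult_mat_vec cong: if_cong)
    have "nsq (rdiag n m s *\<^sub>v x) = (\<Sum>i<n. if i < m then (s $ i)\<^sup>2 * (cmod (x $ i))\<^sup>2 else 0)"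
      unfolding nsq_def dim_mult_mat_vec rdiag_dim
      by (intro sum.cong refl) (simp add: entry norm_mult power_mult_distrib del: index_mult_mat_vec)
    also have "\<dots> = (\<Sum>i<min n m. (s $ i)\<^sup>2 * (cmod (x $ i))\<^sup>2)"
      by (intro sum.mono_neutral_cong_right) auto
    also have "\<dots> \<le> (\<Sum>i<min n m. c\<^sup>2 * (cmod (x $ i))\<^sup>2)"
      using assms by (intro sum_mono mult_right_mono) (auto simp: abs_le_square_iff[symmetric])
    also have "\<dots> \<le> (\<Sum>i<m. c\<^sup>2 * (cmod (x $ i))\<^sup>2)"
      by (intro sum_mono2) auto
    also have "\<dots> = c\<^sup>2 * nsq x"
      using x by (simp add: nsq_def sum_distrib_left)
    finally show ?thesis .
  qed
  then show ?thesis using assms(1) by (simp add: op_bound_def)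
qed

lemma op_bound_spec_norm:
  assumes X: "X \<in> carrier_mat n m"
  shows "op_bound (spec_norm X) X"
proof -
  let ?s = "sing_vals X"
  let ?S = "insert 0 {?s $ i | i. i < dim_vec ?s}"
  have fin: "finite ?S" by simp
  obtain U V where U: "unitary n U" and V: "unitary m V"
    and Xd: "X = U * rdiag n m ?s * mat_adjoint V"
    using svd_of[OF X] by metis
  have "op_bound (spec_norm X) (rdiag n m ?s)"
  proof (rule op_bound_rdiag)
    show "0 \<le> spec_norm X"
      unfolding spec_norm_def using fin by (intro Max_ge) auto
    fix i assume i: "i < min n m"
    have "?s $ i \<le> spec_norm X"
      unfolding spec_norm_def using fin i sing_vals_props(1)[OF X] by (intro Max_ge) auto
    then show "\<bar>?s $ i\<bar> \<le> spec_norm X"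
      using sing_vals_props(2)[OF X i] by simp
  qed
  then have "op_bound (spec_norm X) (U * rdiag n m ?s * mat_adjoint V)"
    by (rule op_bound_unitary[OF _ rdiag_carrier U unitary_adj[OF V]])
  then show ?thesis using Xd by metis
qed

text \<open>In singular vector coordinates of Y the pairing sees only the diagonal of the rotated W,
  whose entries are bounded by c, weighted with the nonnegative singular values.\<close>

lemma minner_le_op_bound_nuc_norm:
  assumes W: "op_bound c W" "W \<in> carrier_mat n m" and Y: "Y \<in> carrier_mat n m"
  shows "minner W Y \<le> c * nuc_norm Y"
proof -
  obtain U V where U: "unitary n U" and V: "unitary m V"
    and Yd: "Y = U * rdiag n m (sing_vals Y) * mat_adjoint V"
    using svd_of[OF Y] by metis
  define Z where "Z = mat_adjoint U * W * V"
  have Z: "Z \<in> carrier_mat n m" "op_bound c Z"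
    using op_bound_unitary[OF W unitary_adj[OF U] V] unitary_carrier[OF U] unitary_carrier[OF V] W(2)
    by (auto simp: Z_def)
  have "minner W Y = minner Y W"
    by (rule minner_commute[OF W(2) Y])
  also have "minner Y W = minner (rdiag n m (sing_vals Y)) Z"
    unfolding Z_def minner_unitary[OF U V rdiag_carrier W(2), symmetric] Yd[symmetric] ..
  also have "\<dots> = (\<Sum>i<min n m. sing_vals Y $ i * Re (Z $$ (i, i)))"
    by (rule minner_rdiag[OF Z(1)])
  also have "\<dots> \<le> (\<Sum>i<min n m. sing_vals Y $ i * c)"
  proof (intro sum_mono mult_left_mono)
    fix i assume i: "i \<in> {..<min n m}"
    have "Re (Z $$ (i, i)) \<le> cmod (Z $$ (i, i))" by (rule complex_Re_le_cmod)
    also have "\<dots> \<le> c" using i by (intro op_bound_entry[OF Z(2,1)]) auto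
    finally show "Re (Z $$ (i, i)) \<le> c" .
    show "0 \<le> sing_vals Y $ i" using i sing_vals_props(2)[OF Y] by simp
  qed
  also have "\<dots> = c * nuc_norm Y"
    using sing_vals_props(1)[OF Y] by (simp add: nuc_norm_def sum_distrib_left mult.commute)
  finally show ?thesis .
qed

text \<open>The witness keeps the singular vectors of Y and replaces every singular value by
  1.\<close>

lemma nuc_norm_attained:
  assumes Y: "Y \<in> carrier_mat n m"
  shows "\<exists>W\<in>carrier_mat n m. op_bound 1 W \<and> minner W Y = nuc_norm Y"
proof -
  obtain U V where U: "unitary n U" and V: "unitary m V"
    and Yd: "Y = U * rdiag n m (sing_vals Y) * mat_adjoint V"
    using svd_of[OF Y] by metis
  let ?E = "rdiag n m (vec (min n m) (\<lambda>_. 1))"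
  let ?W = "U * ?E * mat_adjoint V"
  have "op_bound 1 ?W"
    by (intro op_bound_unitary[OF op_bound_rdiag rdiag_carrier U unitary_adj[OF V]]) auto
  moreover have "minner ?W Y = nuc_norm Y"
  proof -
    have "minner ?W Y = minner ?E (mat_adjoint U * Y * V)"
      by (rule minner_unitary[OF U V rdiag_carrier Y])
    also have "mat_adjoint U * Y * V = rdiag n m (sing_vals Y)"
      using unitary_cancel(1)[OF U V rdiag_carrier[of n m "sing_vals Y"]] Yd by metis
    also have "minner ?E (rdiag n m (sing_vals Y)) = (\<Sum>i<min n m. sing_vals Y $ i)"
      unfolding minner_rdiag[OF rdiag_carrier] by (intro sum.cong) (auto simp: rdiag_def)
    finally show ?thesis
      by (simp add: nuc_norm_def sing_vals_props(1)[OF Y])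
  qed
  moreover have "?W \<in> carrier_mat n m" using U V by (auto simp: unitary_def)
  ultimately show ?thesis by blast
qed

section \<open>Splitting a matrix into its first rows and columns and the lower block\<close>

lemma sum_shift_lessThan: "r \<le> n \<Longrightarrow> (\<Sum>i<n - r. f (i + r)) = (\<Sum>i\<in>{r..<n}. f i)"
  for f :: "nat \<Rightarrow> 'a :: comm_monoid_add"
  by (rule sum.reindex_bij_witness[of _ "\<lambda>i. i - r" "\<lambda>i. i + r"]) auto

lemma sum_split_lessThan:
  "r \<le> n \<Longrightarrow> (\<Sum>i<n. f i) = (\<Sum>i<r. f i) + (\<Sum>i<n - r. f (i + r))"
  for f :: "nat \<Rightarrow> 'a :: comm_monoid_add"
  using sum.atLeastLessThan_concat[of 0 r n f] by (simp only: sum_shift_lessThan) (simp add: lessThan_atLeast0)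

definition corner_mask :: "nat \<Rightarrow> complex mat \<Rightarrow> complex mat" where
  "corner_mask r X = mat (dim_row X) (dim_col X) (\<lambda>(i, j). if i < r \<or> j < r then X $$ (i, j) else 0)"

text \<open>Cut down to its own size instead of padded with zeros, so that it is a matrix with its
  own decomposition and nuclear norm.\<close>

definition lower_block :: "nat \<Rightarrow> complex mat \<Rightarrow> complex mat" where
  "lower_block r X = mat (dim_row X - r) (dim_col X - r) (\<lambda>(i, j). X $$ (i + r, j + r))"

lemma corner_mask_carrier [simp]: "X \<in> carrier_mat n m \<Longrightarrow> corner_mask r X \<in> carrier_mat n m"
  by (simp add: corner_mask_def)

lemma lower_block_carrier [simp]: "X \<in> carrier_mat n m \<Longrightarrow> lower_block r X \<in> carrier_mat (n - r) (m - r)"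
  by (simp add: lower_block_def)

text \<open>The two parts live on disjoint positions; masking one factor of the first term is
  enough, since its zeros remove the other positions.\<close>

lemma minner_corner_lower:
  assumes "X \<in> carrier_mat n m" "Y \<in> carrier_mat n m" "r \<le> n" "r \<le> m"
  shows "minner X Y = minner (corner_mask r X) Y + minner (lower_block r X) (lower_block r Y)"
proof -
  define g where "g = (\<lambda>i j. Re (cnj (X $$ (i, j)) * Y $$ (i, j)))"
  have "minner (corner_mask r X) Y = (\<Sum>i<n. \<Sum>j<m. if i < r \<or> j < r then g i j else 0)"
    unfolding minner_entries[OF corner_mask_carrier[OF assms(1)] assms(2)] using assms
    by (intro sum.cong refl) (auto simp: corner_mask_def g_def)
  moreover have "minner (lower_block r X) (lower_block r Y) = (\<Sum>i<n. \<Sum>j<m. if i < r \<or> j < r then 0 else g i j)"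
    unfolding minner_entries[OF lower_block_carrier[OF assms(1)] lower_block_carrier[OF assms(2)]]
    using assms by (simp add: sum_split_lessThan lower_block_def g_def)
  moreover have "minner X Y = (\<Sum>i<n. \<Sum>j<m. g i j)"
    unfolding minner_entries[OF assms(1,2)] g_def ..
  moreover have "(\<Sum>i<n. \<Sum>j<m. g i j) = (\<Sum>i<n. \<Sum>j<m.
      (if i < r \<or> j < r then g i j else 0) + (if i < r \<or> j < r then 0 else g i j))"
    by (intro sum.cong) auto
  ultimately show ?thesis
    by (simp only: sum.distrib)
qed

text \<open>The masked positions are covered by r rows and r columns, each of squared length at most
  c^2. The common r by r square is counted twice, which only enlarges the bound 2 r c^2;
  Cauchy-Schwarz does the rest.\<close>

lemma minner_corner_le:
  assumes X: "op_bound c X" "X \<in> carrier_mat n m" and Y: "Y \<in> carrier_mat n m" and r: "r \<le> n" "r \<le> m"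
  shows "\<bar>minner (corner_mask r X) Y\<bar> \<le> c * sqrt (2 * real r) * fro_norm Y"
proof -
  let ?a = "\<lambda>i j. (cmod (X $$ (i, j)))\<^sup>2"
  have c: "0 \<le> c" using X by (simp add: op_bound_def)
  have "(fro_norm (corner_mask r X))\<^sup>2 = (\<Sum>i<n. \<Sum>j<m. if i < r \<or> j < r then ?a i j else 0)"
    using X(2) unfolding fro_norm_def
    by (subst real_sqrt_pow2) (auto simp: corner_mask_def sum_nonneg intro!: sum.cong)
  also have "\<dots> \<le> (\<Sum>i<n. \<Sum>j<m. (if i < r then ?a i j else 0) + (if j < r then ?a i j else 0))"
    by (intro sum_mono) auto
  also have "\<dots> = (\<Sum>i<n. \<Sum>j<m. if i < r then ?a i j else 0) + (\<Sum>j<m. \<Sum>i<n. if j < r then ?a i j else 0)"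
    by (subst (2) sum.swap) (simp add: sum.distrib)
  also have "\<dots> = (\<Sum>i<r. \<Sum>j<m. ?a i j) + (\<Sum>j<r. \<Sum>i<n. ?a i j)"
    using r by (intro arg_cong2[of _ _ _ _ "(+)"] sum.mono_neutral_cong_right) auto
  also have "\<dots> \<le> (\<Sum>i<r. c\<^sup>2) + (\<Sum>j<r. c\<^sup>2)"
    using r by (intro add_mono sum_mono op_bound_row[OF X] op_bound_column[OF X]) auto
  also have "\<dots> = (c * sqrt (2 * real r))\<^sup>2"
    by (simp add: power_mult_distrib)
  finally have "(fro_norm (corner_mask r X))\<^sup>2 \<le> (c * sqrt (2 * real r))\<^sup>2" .
  then have "fro_norm (corner_mask r X) \<le> c * sqrt (2 * real r)"
    by (rule power2_le_imp_le) (simp add: c)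
  then show ?thesis
    using Cauchy_Schwarz_minner[OF corner_mask_carrier[OF X(2)] Y, of r] fro_norm_nonneg[of Y]
    by (meson mult_right_mono order_trans)
qed

text \<open>Prepending r zeros to a test vector keeps its norm, and the block applied to it is the
  tail of X applied to the padded vector.\<close>

lemma op_bound_lower_block:
  assumes X: "op_bound c X" "X \<in> carrier_mat n m" and r: "r \<le> n" "r \<le> m"
  shows "op_bound c (lower_block r X)"
proof -
  have "nsq (lower_block r X *\<^sub>v x) \<le> c\<^sup>2 * nsq x" if x: "x \<in> carrier_vec (m - r)" for x
  proof -
    define y where "y = vec m (\<lambda>j. if j < r then 0 else x $ (j - r))"
    have y: "y \<in> carrier_vec m" by (simp add: y_def)
    have nsq_y: "nsq y = nsq x"
      using x r by (simp add: nsq_def y_def sum_split_lessThan)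
    have "(lower_block r X *\<^sub>v x) $ i = (X *\<^sub>v y) $ (i + r)" if "i < n - r" for i
      using that x X(2) r
      by (simp add: mult_vec_index lower_block_def y_def sum_split_lessThan[OF r(2)] del: index_mult_mat_vec)
    then have "nsq (lower_block r X *\<^sub>v x) = (\<Sum>i<n - r. (cmod ((X *\<^sub>v y) $ (i + r)))\<^sup>2)"
      using X(2) unfolding nsq_def by (intro sum.cong) (auto simp: lower_block_def simp del: index_mult_mat_vec)
    also have "\<dots> \<le> nsq (X *\<^sub>v y)"
      using X(2) r by (simp add: nsq_def sum_split_lessThan[OF r(1)] sum_nonneg del: index_mult_mat_vec)
    also have "\<dots> \<le> c\<^sup>2 * nsq x"
      using X y nsq_y by (auto simp: op_bound_def)
    finally show ?thesis .
  qed
  then show ?thesis using X by (auto simp: op_bound_def lower_block_def)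
qed

text \<open>The block diagonal matrix of the identity of size r and W. For W of operator norm at
  most 1 this is the shape of a nuclear norm subgradient at a matrix of rank r, in its singular
  vector coordinates.\<close>

definition block_sum_id :: "nat \<Rightarrow> complex mat \<Rightarrow> complex mat" where
  "block_sum_id r W = mat (r + dim_row W) (r + dim_col W)
     (\<lambda>(i, j). if i < r \<and> j < r then (if i = j then 1 else 0)
        else if i < r \<or> j < r then 0 else W $$ (i - r, j - r))"

lemma block_sum_id_carrier [simp]: "W \<in> carrier_mat n m \<Longrightarrow> block_sum_id r W \<in> carrier_mat (r + n) (r + m)"
  by (auto simp: block_sum_id_def)

lemma op_bound_block_sum_id:
  assumes W: "op_bound 1 W" "W \<in> carrier_mat n m"
  shows "op_bound 1 (block_sum_id r W)"
proof -
  have "nsq (block_sum_id r W *\<^sub>v x) \<le> nsq x" if x: "x \<in> carrier_vec (r + m)" for x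
  proof -
    define y where "y = vec m (\<lambda>j. x $ (j + r))"
    have y: "y \<in> carrier_vec m" by (simp add: y_def)
    have 1: "(block_sum_id r W *\<^sub>v x) $ i = x $ i" if "i < r" for i
      using that x W(2)
      by (simp add: mult_vec_index block_sum_id_def sum_split_lessThan[of r "r + m"] if_distrib[of "\<lambda>z. z * _"]
          del: index_mult_mat_vec cong: if_cong)
    have 2: "(block_sum_id r W *\<^sub>v x) $ (i + r) = (W *\<^sub>v y) $ i" if "i < n" for i
      using that x W(2)
      by (simp add: mult_vec_index block_sum_id_def sum_split_lessThan[of r "r + m"] y_def del: index_mult_mat_vec)
    have "nsq (block_sum_id r W *\<^sub>v x) = (\<Sum>i<r. (cmod (x $ i))\<^sup>2) + nsq (W *\<^sub>v y)"
    proof -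
      have "dim_vec (block_sum_id r W *\<^sub>v x) = r + n" "dim_vec (W *\<^sub>v y) = n"
        using W(2) by (simp_all add: block_sum_id_def)
      then show ?thesis
        by (simp add: nsq_def sum_split_lessThan[of r "r + n"] 1 2 del: index_mult_mat_vec dim_mult_mat_vec)
    qed
    also have "nsq (W *\<^sub>v y) \<le> nsq y"
      using W y by (auto simp: op_bound_def)
    also have "(\<Sum>i<r. (cmod (x $ i))\<^sup>2) + nsq y = nsq x"
      using x by (simp add: nsq_def sum_split_lessThan[of r "r + m"] y_def)
    finally show ?thesis by simp
  qed
  then show ?thesis using W by (auto simp: op_bound_def block_sum_id_def)
qed

section \<open>Rank and singular values\<close>

text \<open>A maximal independent set of columns serves as B, and C collects the coefficients of all
  columns over it. The factorisation is the form of the rank that survives unitary changes of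
  coordinates.\<close>

lemma rank_factorization:
  fixes X :: "'a :: field mat"
  assumes X: "X \<in> carrier_mat n m"
  defines "r \<equiv> vec_space.rank n X"
  shows "r \<le> n" "r \<le> m" "\<exists>B C. B \<in> carrier_mat n r \<and> C \<in> carrier_mat r m \<and> X = B * C"
proof -
  interpret vec_space "TYPE('a)" n .
  let ?P = "\<lambda>T. T \<subseteq> set (cols X) \<and> lin_indpt T"
  have "?P {}" by (simp add: finite_lin_indpt2)
  then obtain S where S: "finite S" "maximal S ?P"
    using maximal_exists_superset[of "set (cols X)" ?P "{}"] by auto
  have r: "r = card S" unfolding r_def by (rule rank_card_indpt[OF X S(2)])
  have SX: "S \<subseteq> set (cols X)" and li: "lin_indpt S"
    using S(2) by (auto simp: maximal_def)
  have Xc: "set (cols X) \<subseteq> carrier_vec n" using X cols_dim by blast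
  then have Sc: "S \<subseteq> carrier_vec n" using SX by blast
  show "r \<le> n"
    using li_le_dim(2)[OF fin_dim _ li] Sc unfolding r dim_is_n by auto
  show "r \<le> m" unfolding r_def by (rule rank_le_nc[OF X])
  obtain ss where ss: "set ss = S" "distinct ss"
    using finite_distinct_list[OF S(1)] by blast
  have len: "length ss = r" using distinct_card[OF ss(2)] ss(1) r by simp
  define B where "B = mat_of_cols n ss"
  have B: "B \<in> carrier_mat n r" by (simp add: B_def len mat_of_cols_carrier(1)[of n ss, unfolded len])
  have colsB: "cols B = ss" unfolding B_def using Sc ss(1) by (intro cols_mat_of_cols) auto
  have "\<exists>w. w \<in> carrier_vec r \<and> B *\<^sub>v w = c" if c: "c \<in> set (cols X)" for c
  proof -
    have "c \<in> span S"
    proof (cases "c \<in> S")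
      case True
      then show ?thesis using span_mem[of S c] Sc by auto
    next
      case False
      \<comment> \<open>Otherwise \<open>insert c S\<close> would be a larger independent set of
        columns, against maximality.\<close>
      then have "lin_dep (insert c S)"
        using S(2) SX c unfolding maximal_def by (metis insert_subset subset_insertI insertI1)
      then show ?thesis
        using lin_dep_iff_in_span[of S c] Sc li False c Xc by auto
    qed
    then obtain a where "c = lincomb a S"
      using finite_in_span[of S c] S(1) Sc by auto
    then have "B *\<^sub>v vec r (\<lambda>i. a (col B i)) = c"
      using mat_mult_eq_lincomb[OF B, of a] colsB ss by simp
    then show ?thesis by (intro exI[of _ "vec r (\<lambda>i. a (col B i))"]) simp
  qed
  then have "\<forall>j<m. \<exists>w. w \<in> carrier_vec r \<and> B *\<^sub>v w = col X j"
    using X by (metis carrier_matD(2) cols_length cols_nth nth_mem)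
  then obtain w where w: "\<And>j. j < m \<Longrightarrow> w j \<in> carrier_vec r \<and> B *\<^sub>v w j = col X j"
    by metis
  define C where "C = mat_of_cols r (map w [0..<m])"
  have C: "C \<in> carrier_mat r m" by (simp add: C_def mat_of_cols_def)
  have "X = B * C"
  proof (rule mat_col_eqI)
    fix j assume "j < dim_col (B * C)"
    then have j: "j < m" using C by simp
    have "col (B * C) j = B *\<^sub>v col C j" by (rule col_mult2[OF B C j])
    also have "col C j = w j" using j w[OF j] by (simp add: C_def)
    finally show "col X j = col (B * C) j" using w[OF j] by simp
  qed (use X B C in auto)
  then show "\<exists>B C. B \<in> carrier_mat n r \<and> C \<in> carrier_mat r m \<and> X = B * C"
    using B C by blast
qed

text \<open>Padding both factors with zeros to size k keeps the product and gives the left one a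
  zero column r, so the determinant of the product vanishes; for a diagonal product it is the
  product of the diagonal.\<close>

lemma factor_diag_eq_0:
  fixes L R :: "complex mat"
  assumes L: "L \<in> carrier_mat k r" and R: "R \<in> carrier_mat r k" and rk: "r < k"
    and diag: "\<And>i j. i < k \<Longrightarrow> j < k \<Longrightarrow> i \<noteq> j \<Longrightarrow> (L * R) $$ (i, j) = 0"
  shows "\<exists>i<k. (L * R) $$ (i, i) = 0"
proof -
  define L' where "L' = mat k k (\<lambda>(i, j). if j < r then L $$ (i, j) else 0)"
  define R' where "R' = mat k k (\<lambda>(i, j). if i < r then R $$ (i, j) else 0)"
  have c: "L' \<in> carrier_mat k k" "R' \<in> carrier_mat k k" by (simp_all add: L'_def R'_def)
  have LR: "L' * R' = L * R"
  proof (rule eq_matI)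
    fix i j assume "i < dim_row (L * R)" "j < dim_col (L * R)"
    then have ij: "i < k" "j < k" using L R by auto
    have "(L' * R') $$ (i, j) = (\<Sum>l<k. if l < r then L $$ (i, l) * R $$ (l, j) else 0)"
      using ij by (simp add: mult_index L'_def R'_def if_distrib[of "\<lambda>z. z * _"] del: index_mult_mat(1) cong: if_cong)
    also have "\<dots> = (\<Sum>l<r. L $$ (i, l) * R $$ (l, j))"
      using rk by (intro sum.mono_neutral_cong_right) auto
    also have "\<dots> = (L * R) $$ (i, j)" using ij L R by (simp add: mult_index del: index_mult_mat(1))
    finally show "(L' * R') $$ (i, j) = (L * R) $$ (i, j)" .
  qed (use L R c in auto)
  have "L' *\<^sub>v unit_vec k r = 0\<^sub>v k"
    using rk by (intro eq_vecI) (auto simp: L'_def scalar_prod_right_unit)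
  moreover have "unit_vec k r \<noteq> 0\<^sub>v k"
    using rk by (metis index_unit_vec(1) index_zero_vec(1) zero_neq_one)
  ultimately have "det L' = 0"
    using det_0_iff_vec_prod_zero[OF c(1)] unit_vec_carrier by blast
  then have "det (L * R) = 0" using det_mult[OF c] LR by simp
  moreover have LRc: "L * R \<in> carrier_mat k k" using L R by auto
  moreover have "upper_triangular (L * R)"
    using LRc diag by (auto simp: upper_triangular_def)
  ultimately have "0 \<in> set (diag_mat (L * R))"
    using det_upper_triangular[of "L * R" k] by (auto simp: prod_list_zero_iff)
  then show ?thesis
    unfolding diag_mat_def carrier_matD(1)[OF LRc] by (auto simp del: index_mult_mat(1))
qed

text \<open>The diagonal factor inherits a factorisation through dimension r. A leading block larger
  than r must then have a zero on its diagonal, and monotonicity moves this zero to the end of the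
  block.\<close>

lemma rank_svd:
  assumes svd: "is_svd X U s V" and X: "X \<in> carrier_mat n m" and r: "mat_rank X = r"
  shows "r \<le> n" "r \<le> m" "\<And>i. r \<le> i \<Longrightarrow> i < min n m \<Longrightarrow> s $ i = 0"
proof -
  have r': "vec_space.rank n X = r" using r X by (simp add: mat_rank_def)
  show "r \<le> n" "r \<le> m" using rank_factorization(1,2)[OF X] r' by auto
  obtain B C where B: "B \<in> carrier_mat n r" and C: "C \<in> carrier_mat r m" and XBC: "X = B * C"
    using rank_factorization(3)[OF X] r' by auto
  have U: "unitary n U" and V: "unitary m V" and Xd: "X = U * rdiag n m s * mat_adjoint V"
    and s: "dim_vec s = min n m" "\<And>i. i < min n m \<Longrightarrow> 0 \<le> s $ i"
    "\<And>i j. i \<le> j \<Longrightarrow> j < min n m \<Longrightarrow> s $ j \<le> s $ i"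
    using svd unfolding is_svd_def carrier_matD[OF X] by auto
  have Uc: "U \<in> carrier_mat n n" and Vc: "V \<in> carrier_mat m m" using U V by auto
  show "s $ i = 0" if i: "r \<le> i" "i < min n m" for i
  proof -
    have "rdiag n m s = mat_adjoint U * (B * C) * V"
      using unitary_cancel(1)[OF U V rdiag_carrier[of n m s]] Xd XBC by metis
    also have "\<dots> = (mat_adjoint U * B) * (C * V)"
      using Uc Vc B C by (simp add: mult_assoc_dim)
    finally have fac: "rdiag n m s = (mat_adjoint U * B) * (C * V)" .
    \<comment> \<open>The block has size \<open>Suc i\<close>: it exceeds r because r \<le> i, and
      all its indices a satisfy a \<le> i, so that a zero at a forces one at i.\<close>
    define L where "L = mat (Suc i) r (\<lambda>(a, b). (mat_adjoint U * B) $$ (a, b))"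
    define R where "R = mat r (Suc i) (\<lambda>(a, b). (C * V) $$ (a, b))"
    have LR: "(L * R) $$ (a, b) = rdiag n m s $$ (a, b)" if "a < Suc i" "b < Suc i" for a b
      unfolding fac using that i Uc Vc B C
      by (simp add: mult_index L_def R_def del: index_mult_mat(1))
    have "\<exists>a<Suc i. (L * R) $$ (a, a) = 0"
      using i LR by (intro factor_diag_eq_0[of _ _ r]) (auto simp: L_def R_def rdiag_def simp del: index_mult_mat(1))
    then obtain a where a: "a < Suc i" "(L * R) $$ (a, a) = 0" by blast
    have "s $ a = 0"
      using LR[OF a(1,1)] a i by (simp add: rdiag_def del: index_mult_mat(1))
    then show ?thesis using s(2)[OF i(2)] s(3)[of a i] a(1) i(2) by simp
  qed
qed

section \<open>The tangent space projections in singular vector coordinates\<close>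

lemma svd_entry:
  assumes "U \<in> carrier_mat n n" "V \<in> carrier_mat m m" "i < n" "j < m"
  shows "(U * rdiag n m s * mat_adjoint V) $$ (i, j) =
    (\<Sum>l<min n m. complex_of_real (s $ l) * U $$ (i, l) * cnj (V $$ (j, l)))"
proof -
  have US: "(U * rdiag n m s) $$ (i, l) = (if l < n then complex_of_real (s $ l) * U $$ (i, l) else 0)"
    if "l < m" for l
    using assms that by (simp add: mult_index rdiag_def if_distrib[of "\<lambda>z. _ * z"] mult.commute
        del: index_mult_mat(1) cong: if_cong)
  have "(U * rdiag n m s * mat_adjoint V) $$ (i, j) =
      (\<Sum>l<m. if l < n then complex_of_real (s $ l) * U $$ (i, l) * cnj (V $$ (j, l)) else 0)"
    using assms by (simp add: mult_index[where B = "mat_adjoint V"] US if_distrib[of "\<lambda>z. z * _"]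
        del: index_mult_mat(1) cong: if_cong)
  also have "\<dots> = (\<Sum>l<min n m. complex_of_real (s $ l) * U $$ (i, l) * cnj (V $$ (j, l)))"
    by (intro sum.mono_neutral_cong_right) auto
  finally show ?thesis .
qed

text \<open>For n = m the coordinate projector onto the first r axes; in general the coordinates of
  the product of the leading singular vectors. Writing truncated column blocks this way leaves only
  full unitary factors, which cancel.\<close>

definition head_diag :: "nat \<Rightarrow> nat \<Rightarrow> nat \<Rightarrow> complex mat" where
  "head_diag n m r = rdiag n m (vec (min n m) (\<lambda>i. if i < r then 1 else 0))"

definition tail_diag :: "nat \<Rightarrow> nat \<Rightarrow> nat \<Rightarrow> complex mat" where
  "tail_diag n m r = rdiag n m (vec (min n m) (\<lambda>i. if i < r then 0 else 1))"

lemma head_tail_carrier [simp]: "head_diag n m r \<in> carrier_mat n m" "tail_diag n m r \<in> carrier_mat n m"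
  by (simp_all add: head_diag_def tail_diag_def)

lemma head_tail_dim [simp]:
  "dim_row (head_diag n m r) = n" "dim_col (head_diag n m r) = m"
  "dim_row (tail_diag n m r) = n" "dim_col (tail_diag n m r) = m"
  by (simp_all add: head_diag_def tail_diag_def)

lemma first_cols_mult_adj:
  assumes U: "U \<in> carrier_mat n n" and V: "V \<in> carrier_mat m m" and r: "r \<le> n" "r \<le> m"
  shows "first_cols r U * mat_adjoint (first_cols r V) = U * head_diag n m r * mat_adjoint V"
proof (rule eq_matI)
  fix i j assume "i < dim_row (U * head_diag n m r * mat_adjoint V)"
    "j < dim_col (U * head_diag n m r * mat_adjoint V)"
  then have ij: "i < n" "j < m" using U V by auto
  have "(U * head_diag n m r * mat_adjoint V) $$ (i, j) =
      (\<Sum>l<min n m. if l < r then U $$ (i, l) * cnj (V $$ (j, l)) else 0)"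
    unfolding head_diag_def svd_entry[OF U V ij] by (intro sum.cong) auto
  also have "\<dots> = (\<Sum>l<r. U $$ (i, l) * cnj (V $$ (j, l)))"
    using r by (intro sum.mono_neutral_cong_right) auto
  also have "\<dots> = (first_cols r U * mat_adjoint (first_cols r V)) $$ (i, j)"
    using ij U V by (simp add: mult_index first_cols_def del: index_mult_mat(1))
  finally show "(first_cols r U * mat_adjoint (first_cols r V)) $$ (i, j) =
    (U * head_diag n m r * mat_adjoint V) $$ (i, j)" ..
qed (use U V in \<open>auto simp: first_cols_def\<close>)

lemma last_cols_mult_adj:
  assumes U: "U \<in> carrier_mat n n" and r: "r \<le> n"
  shows "last_cols r U * mat_adjoint (last_cols r U) = U * tail_diag n n r * mat_adjoint U"
proof (rule eq_matI)
  fix i j assume "i < dim_row (U * tail_diag n n r * mat_adjoint U)"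
    "j < dim_col (U * tail_diag n n r * mat_adjoint U)"
  then have ij: "i < n" "j < n" using U by auto
  have "(U * tail_diag n n r * mat_adjoint U) $$ (i, j) =
      (\<Sum>l<n. if l < r then 0 else U $$ (i, l) * cnj (U $$ (j, l)))"
    unfolding tail_diag_def svd_entry[OF U U ij] by (intro sum.cong) auto
  also have "\<dots> = (\<Sum>l<n - r. U $$ (i, l + r) * cnj (U $$ (j, l + r)))"
    by (simp add: sum_split_lessThan[OF r])
  also have "\<dots> = (last_cols r U * mat_adjoint (last_cols r U)) $$ (i, j)"
    using ij U by (simp add: mult_index last_cols_def del: index_mult_mat(1))
  finally show "(last_cols r U * mat_adjoint (last_cols r U)) $$ (i, j) =
    (U * tail_diag n n r * mat_adjoint U) $$ (i, j)" ..
qed (use U in \<open>auto simp: last_cols_def\<close>)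

lemma rdiag_square_mult:
  assumes "Y \<in> carrier_mat n m" "i < n" "j < m"
  shows "(rdiag n n s * Y) $$ (i, j) = complex_of_real (s $ i) * Y $$ (i, j)"
    and "(Y * rdiag m m s) $$ (i, j) = complex_of_real (s $ j) * Y $$ (i, j)"
  using assms by (simp_all add: mult_index rdiag_def if_distrib[of "\<lambda>z. _ * z"] if_distrib[of "\<lambda>z. z * _"]
      mult.commute del: index_mult_mat(1) cong: if_cong)

lemma unitary_conj_diag:
  assumes U: "unitary n U" and V: "unitary m V" and Y: "Y \<in> carrier_mat n m"
    and p: "p \<in> carrier_mat n n" and q: "q \<in> carrier_mat m m"
  shows "U * p * mat_adjoint U * (U * Y * mat_adjoint V) = U * (p * Y) * mat_adjoint V"
    and "U * Y * mat_adjoint V * (V * q * mat_adjoint V) = U * (Y * q) * mat_adjoint V"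
proof -
  have c: "U \<in> carrier_mat n n" "V \<in> carrier_mat m m" using U V by auto
  have "U * p * mat_adjoint U * (U * Y * mat_adjoint V) = U * (p * ((mat_adjoint U * U) * (Y * mat_adjoint V)))"
    using c Y p by (simp add: mult_assoc_dim)
  also have "\<dots> = U * (p * Y) * mat_adjoint V"
    using c Y p U by (simp add: unitary_def mult_assoc_dim left_mult_one_mat' )
  finally show "U * p * mat_adjoint U * (U * Y * mat_adjoint V) = U * (p * Y) * mat_adjoint V" .
  have "U * Y * mat_adjoint V * (V * q * mat_adjoint V) = U * (Y * ((mat_adjoint V * V) * (q * mat_adjoint V)))"
    using c Y q by (simp add: mult_assoc_dim)
  also have "\<dots> = U * (Y * q) * mat_adjoint V"
    using c Y q V by (simp add: unitary_def mult_assoc_dim left_mult_one_mat')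
  finally show "U * Y * mat_adjoint V * (V * q * mat_adjoint V) = U * (Y * q) * mat_adjoint V" .
qed

text \<open>The outer projectors turn into diagonal p on the left and q on the right, and p Y + Y q
  - p Y q is inclusion-exclusion for the condition i < r or j < r.\<close>

lemma P_T_coordinates:
  assumes U: "unitary n U" and V: "unitary m V" and X: "X \<in> carrier_mat n m" and r: "r \<le> n" "r \<le> m"
  shows "P_T (first_cols r U) (first_cols r V) X = U * corner_mask r (mat_adjoint U * X * V) * mat_adjoint V"
proof -
  define Y where "Y = mat_adjoint U * X * V"
  have c: "U \<in> carrier_mat n n" "V \<in> carrier_mat m m" using U V by auto
  have Y: "Y \<in> carrier_mat n m" using c X by (auto simp: Y_def)
  have XY: "X = U * Y * mat_adjoint V"
    unfolding Y_def by (rule unitary_cancel(2)[OF U V X, symmetric])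
  let ?p = "head_diag n n r" and ?q = "head_diag m m r"
  have pY: "?p * Y \<in> carrier_mat n m" and Yq: "Y * ?q \<in> carrier_mat n m" and pYq: "?p * Y * ?q \<in> carrier_mat n m"
    using Y by (auto intro!: mult_carrier_mat)
  have "P_T (first_cols r U) (first_cols r V) X =
      (first_cols r U * mat_adjoint (first_cols r U)) * X + X * (first_cols r V * mat_adjoint (first_cols r V))
      - (first_cols r U * mat_adjoint (first_cols r U)) * X * (first_cols r V * mat_adjoint (first_cols r V))"
    using c X by (simp add: P_T_def mult_assoc_dim first_cols_def)
  also have "\<dots> = U * (?p * Y) * mat_adjoint V + U * (Y * ?q) * mat_adjoint V - U * (?p * Y * ?q) * mat_adjoint V"
    unfolding first_cols_mult_adj[OF c(1,1) r(1,1)] first_cols_mult_adj[OF c(2,2) r(2,2)] XY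
      unitary_conj_diag(1)[OF U V Y head_tail_carrier(1) head_tail_carrier(1)]
      unitary_conj_diag(2)[OF U V Y head_tail_carrier(1) head_tail_carrier(1)]
      unitary_conj_diag(2)[OF U V pY head_tail_carrier(1) head_tail_carrier(1)] ..
  also have "\<dots> = U * (?p * Y + Y * ?q - ?p * Y * ?q) * mat_adjoint V"
    using c pY Yq pYq
    by (simp add: mult_add_distrib_mat[of _ n n _ m] mult_minus_distrib_mat[of _ n n _ m]
        add_mult_distrib_mat[of _ n m _ _ m] minus_mult_distrib_mat[of _ n m _ _ m] minus_carrier_mat
        mult_carrier_mat[of _ n n _ m])
  also have "?p * Y + Y * ?q - ?p * Y * ?q = corner_mask r Y"
  proof (rule eq_matI)
    fix i j assume "i < dim_row (corner_mask r Y)" "j < dim_col (corner_mask r Y)"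
    then have ij: "i < n" "j < m" using Y by (auto simp: corner_mask_def)
    have "(?p * Y) $$ (i, j) = (if i < r then Y $$ (i, j) else 0)"
      "(Y * ?q) $$ (i, j) = (if j < r then Y $$ (i, j) else 0)"
      "(?p * Y * ?q) $$ (i, j) = (if i < r \<and> j < r then Y $$ (i, j) else 0)"
      unfolding head_diag_def
      by (simp_all only: rdiag_square_mult(1)[OF Y ij] rdiag_square_mult(2)[OF Y ij]
          rdiag_square_mult(2)[OF pY[unfolded head_diag_def] ij]) (use ij in auto)
    then show "(?p * Y + Y * ?q - ?p * Y * ?q) $$ (i, j) = corner_mask r Y $$ (i, j)"
      using ij Y pYq pY Yq by (simp add: corner_mask_def del: index_mult_mat(1))
  qed (use Y pYq in \<open>auto simp: corner_mask_def\<close>)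
  finally show ?thesis by (simp only: Y_def)
qed

text \<open>Equality of the lower blocks is what carries the spectral norm of the projected matrix
  over to the lower block of X itself.\<close>

lemma P_Tperp_coordinates:
  assumes U: "unitary n U" and V: "unitary m V" and X: "X \<in> carrier_mat n m" and r: "r \<le> n" "r \<le> m"
  shows "P_Tperp (last_cols r U) (last_cols r V) X \<in> carrier_mat n m"
    and "lower_block r (mat_adjoint U * P_Tperp (last_cols r U) (last_cols r V) X * V)
      = lower_block r (mat_adjoint U * X * V)"
proof -
  define Y where "Y = mat_adjoint U * X * V"
  have c: "U \<in> carrier_mat n n" "V \<in> carrier_mat m m" using U V by auto
  have Y: "Y \<in> carrier_mat n m" using c X by (auto simp: Y_def)
  have XY: "X = U * Y * mat_adjoint V"
    unfolding Y_def by (rule unitary_cancel(2)[OF U V X, symmetric])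
  let ?p = "tail_diag n n r" and ?q = "tail_diag m m r"
  have pY: "?p * Y \<in> carrier_mat n m" and pYq: "?p * Y * ?q \<in> carrier_mat n m"
    using Y by (auto intro!: mult_carrier_mat)
  show car: "P_Tperp (last_cols r U) (last_cols r V) X \<in> carrier_mat n m"
    using c X by (auto simp: P_Tperp_def last_cols_def)
  have "P_Tperp (last_cols r U) (last_cols r V) X =
      (last_cols r U * mat_adjoint (last_cols r U)) * X * (last_cols r V * mat_adjoint (last_cols r V))"
    using c X by (simp add: P_Tperp_def mult_assoc_dim last_cols_def)
  also have "\<dots> = U * (?p * Y * ?q) * mat_adjoint V"
    unfolding last_cols_mult_adj[OF c(1) r(1)] last_cols_mult_adj[OF c(2) r(2)] XY
      unitary_conj_diag(1)[OF U V Y head_tail_carrier(2) head_tail_carrier(2)]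
      unitary_conj_diag(2)[OF U V pY head_tail_carrier(2) head_tail_carrier(2)] ..
  finally have "mat_adjoint U * P_Tperp (last_cols r U) (last_cols r V) X * V = ?p * Y * ?q"
    using unitary_cancel(1)[OF U V pYq] by simp
  moreover have "lower_block r (?p * Y * ?q) = lower_block r Y"
  proof (rule eq_matI)
    fix i j assume "i < dim_row (lower_block r Y)" "j < dim_col (lower_block r Y)"
    then have ij: "i + r < n" "j + r < m" using Y by (auto simp: lower_block_def)
    have "(?p * Y * ?q) $$ (i + r, j + r) = Y $$ (i + r, j + r)"
      unfolding tail_diag_def
      by (simp only: rdiag_square_mult(1)[OF Y ij] rdiag_square_mult(2)[OF pY[unfolded tail_diag_def] ij])
        (use ij in auto)
    then show "lower_block r (?p * Y * ?q) $$ (i, j) = lower_block r Y $$ (i, j)"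
      using ij Y pYq by (simp add: lower_block_def del: index_mult_mat(1))
  qed (use Y pYq in \<open>auto simp: lower_block_def\<close>)
  ultimately show "lower_block r (mat_adjoint U * P_Tperp (last_cols r U) (last_cols r V) X * V)
      = lower_block r (mat_adjoint U * X * V)"
    by (simp only: Y_def)
qed

section \<open>The error bound\<close>

text \<open>Pair Z with U diag(I, W0) V^*, where W0 attains the nuclear norm of the lower block of
  the difference. The test matrix has operator norm at most 1, so this is at most
  \<open>nuc_norm Z\<close>; on X it gives exactly \<open>nuc_norm X\<close>, because the singular
  values from index r on vanish and W0 is never seen.\<close>

theorem nuc_norm_subgradient:
  assumes svd: "is_svd X U (sing_vals X) V" and X: "X \<in> carrier_mat n m" and Z: "Z \<in> carrier_mat n m"
    and r: "mat_rank X = r"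
  shows "nuc_norm X + minner (first_cols r U * mat_adjoint (first_cols r V)) (Z - X)
    + nuc_norm (lower_block r (mat_adjoint U * (Z - X) * V)) \<le> nuc_norm Z"
proof -
  let ?s = "sing_vals X"
  have rn: "r \<le> n" "r \<le> m" and tail: "\<And>i. r \<le> i \<Longrightarrow> i < min n m \<Longrightarrow> ?s $ i = 0"
    using rank_svd[OF svd X r] by auto
  have U: "unitary n U" and V: "unitary m V" and Xd: "X = U * rdiag n m ?s * mat_adjoint V"
    using svd unfolding is_svd_def carrier_matD[OF X] by auto
  have c: "U \<in> carrier_mat n n" "V \<in> carrier_mat m m" using U V by auto
  have D: "Z - X \<in> carrier_mat n m" using X Z by (simp add: minus_carrier_mat)
  define Y where "Y = mat_adjoint U * (Z - X) * V"
  have Y: "Y \<in> carrier_mat n m" using c D unfolding Y_def by (auto intro!: mult_carrier_mat)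
  obtain W0 where W0: "W0 \<in> carrier_mat (n - r) (m - r)" "op_bound 1 W0"
    and W0Y: "minner W0 (lower_block r Y) = nuc_norm (lower_block r Y)"
    using nuc_norm_attained[OF lower_block_carrier[OF Y]] by blast
  define W where "W = block_sum_id r W0"
  have W: "W \<in> carrier_mat n m"
    using block_sum_id_carrier[OF W0(1), of r] rn by (simp add: W_def)
  have "op_bound 1 W" unfolding W_def by (rule op_bound_block_sum_id[OF W0(2,1)])
  then have "op_bound 1 (U * W * mat_adjoint V)"
    by (rule op_bound_unitary[OF _ W U unitary_adj[OF V]])
  moreover have UWV: "U * W * mat_adjoint V \<in> carrier_mat n m"
    using c W by (auto intro!: mult_carrier_mat)
  ultimately have le: "minner (U * W * mat_adjoint V) Z \<le> nuc_norm Z"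
    using minner_le_op_bound_nuc_norm[OF _ UWV Z, of 1] by simp
  have "minner (U * W * mat_adjoint V) X = minner W (rdiag n m ?s)"
    unfolding minner_unitary[OF U V W X]
    using unitary_cancel(1)[OF U V rdiag_carrier[of n m ?s]] Xd by metis
  also have "\<dots> = minner (rdiag n m ?s) W"
    by (rule minner_commute[OF W rdiag_carrier])
  also have "\<dots> = (\<Sum>i<min n m. ?s $ i)"
    unfolding minner_rdiag[OF W]
  proof (rule sum.cong[OF refl])
    fix i assume "i \<in> {..<min n m}"
    then show "?s $ i * Re (W $$ (i, i)) = ?s $ i"
      using tail[of i] W0(1) rn by (cases "i < r") (auto simp: W_def block_sum_id_def)
  qed
  finally have 1: "minner (U * W * mat_adjoint V) X = nuc_norm X"
    by (simp add: nuc_norm_def sing_vals_props(1)[OF X])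
  have "minner (U * W * mat_adjoint V) (Z - X) = minner W Y"
    unfolding Y_def by (rule minner_unitary[OF U V W D])
  also have "\<dots> = minner (corner_mask r W) Y + minner (lower_block r W) (lower_block r Y)"
    by (rule minner_corner_lower[OF W Y rn])
  also have "lower_block r W = W0"
    using W0(1) W rn by (intro eq_matI) (auto simp: lower_block_def W_def block_sum_id_def)
  also have "corner_mask r W = head_diag n m r"
    using W0(1) W rn by (intro eq_matI) (auto simp: corner_mask_def W_def block_sum_id_def head_diag_def rdiag_def)
  also have "minner (head_diag n m r) Y = minner (first_cols r U * mat_adjoint (first_cols r V)) (Z - X)"
    unfolding Y_def first_cols_mult_adj[OF c rn]
    by (rule minner_unitary[OF U V head_tail_carrier(1) D, symmetric])
  finally have "minner (U * W * mat_adjoint V) Z - minner (U * W * mat_adjoint V) X =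
      minner (first_cols r U * mat_adjoint (first_cols r V)) (Z - X) + nuc_norm (lower_block r Y)"
    unfolding W0Y minner_diff_right[OF UWV Z X] .
  then show ?thesis using le 1 by (simp add: Y_def)
qed

section \<open>Upper bounds for linear functionals of the error\<close>

lemma nuc_norm_nonneg: "0 \<le> nuc_norm X"
proof -
  have "X \<in> carrier_mat (dim_row X) (dim_col X)" by simp
  from sing_vals_props[OF this] show ?thesis
    unfolding nuc_norm_def by (intro sum_nonneg) simp
qed

text \<open>Meant for the noise matrix, about which only the spectral norm is known; hence one
  constant for both parts.\<close>

lemma minner_split_le:
  assumes X: "X \<in> carrier_mat n m" and D: "D \<in> carrier_mat n m" and U: "unitary n U" and V: "unitary m V"
    and r: "r \<le> n" "r \<le> m"
  shows "minner X D \<le> spec_norm X * (sqrt (2 * real r) * fro_norm D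
    + nuc_norm (lower_block r (mat_adjoint U * D * V)))"
proof -
  define X' where "X' = mat_adjoint U * X * V"
  define D' where "D' = mat_adjoint U * D * V"
  have c: "U \<in> carrier_mat n n" "V \<in> carrier_mat m m" using U V by auto
  have X': "X' \<in> carrier_mat n m" and D': "D' \<in> carrier_mat n m"
    using c X D unfolding X'_def D'_def by (auto intro!: mult_carrier_mat)
  have bX: "op_bound (spec_norm X) X'"
    unfolding X'_def by (rule op_bound_unitary[OF op_bound_spec_norm[OF X] X unitary_adj[OF U] V])
  have "minner X D = minner X' D'"
    using minner_unitary[OF U V X' D] unitary_cancel(2)[OF U V X] by (simp add: X'_def D'_def)
  also have "\<dots> = minner (corner_mask r X') D' + minner (lower_block r X') (lower_block r D')"
    by (rule minner_corner_lower[OF X' D' r])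
  also have "\<dots> \<le> spec_norm X * sqrt (2 * real r) * fro_norm D' + spec_norm X * nuc_norm (lower_block r D')"
    using minner_corner_le[OF bX X' D' r]
      minner_le_op_bound_nuc_norm[OF op_bound_lower_block[OF bX X' r] lower_block_carrier[OF X'] lower_block_carrier[OF D']]
    by linarith
  also have "fro_norm D' = fro_norm D"
    unfolding D'_def by (rule fro_norm_unitary[OF U V D])
  finally show ?thesis by (simp add: D'_def algebra_simps)
qed

text \<open>E has no lower block in these coordinates, so subtracting it changes the tangent part
  alone. This is how the two parts receive the separate constants \<open>a_m\<close> and
  \<open>1 - b_m\<close>.\<close>

lemma minner_head_minus_le:
  assumes G: "G \<in> carrier_mat n m" and D: "D \<in> carrier_mat n m" and U: "unitary n U" and V: "unitary m V"
    and r: "r \<le> n" "r \<le> m"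
  defines "E \<equiv> first_cols r U * mat_adjoint (first_cols r V)"
    and "M \<equiv> nuc_norm (lower_block r (mat_adjoint U * D * V))"
  shows "minner G D - minner E D \<le>
    spec_norm (E - P_T (first_cols r U) (first_cols r V) G) * sqrt (2 * real r) * fro_norm D
    + spec_norm (P_Tperp (last_cols r U) (last_cols r V) G) * M"
proof -
  define G' where "G' = mat_adjoint U * G * V"
  define D' where "D' = mat_adjoint U * D * V"
  define A where "A = E - P_T (first_cols r U) (first_cols r V) G"
  define B where "B = P_Tperp (last_cols r U) (last_cols r V) G"
  define H where "H = head_diag n m r"
  have c: "U \<in> carrier_mat n n" "V \<in> carrier_mat m m" using U V by auto
  have G': "G' \<in> carrier_mat n m" and D': "D' \<in> carrier_mat n m"
    using c G D unfolding G'_def D'_def by (auto intro!: mult_carrier_mat)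
  have H: "H \<in> carrier_mat n m" by (simp add: H_def)
  have Ed: "E = U * H * mat_adjoint V"
    unfolding E_def H_def by (rule first_cols_mult_adj[OF c r])
  have Pd: "P_T (first_cols r U) (first_cols r V) G = U * corner_mask r G' * mat_adjoint V"
    unfolding G'_def by (rule P_T_coordinates[OF U V G r])
  have cG: "corner_mask r G' \<in> carrier_mat n m" using G' by simp
  have E: "E \<in> carrier_mat n m" unfolding Ed using c H by (auto intro!: mult_carrier_mat)
  have P: "P_T (first_cols r U) (first_cols r V) G \<in> carrier_mat n m"
    unfolding Pd using c cG by (auto intro!: mult_carrier_mat)
  have A: "A \<in> carrier_mat n m" using E P by (simp add: A_def minus_carrier_mat)
  have Ad: "A = U * (H - corner_mask r G') * mat_adjoint V"
    unfolding A_def Ed Pd using c H cG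
    by (simp add: mult_minus_distrib_mat[of _ n n _ m] minus_mult_distrib_mat[of _ n m _ _ m]
        mult_carrier_mat[of _ n n _ m])
  have HG: "H - corner_mask r G' \<in> carrier_mat n m" using H cG by (simp add: minus_carrier_mat)
  have A': "mat_adjoint U * A * V = H - corner_mask r G'"
    unfolding Ad by (rule unitary_cancel(1)[OF U V HG])
  have bA: "op_bound (spec_norm A) (H - corner_mask r G')"
    unfolding A'[symmetric] by (rule op_bound_unitary[OF op_bound_spec_norm[OF A] A unitary_adj[OF U] V])
  \<comment> \<open>The corner estimate speaks about masked matrices only; this difference is its
    own mask because the head diagonal is supported on indices below r.\<close>
  have mask: "corner_mask r (H - corner_mask r G') = H - corner_mask r G'"
    using H G' by (intro eq_matI) (auto simp: corner_mask_def H_def head_diag_def rdiag_def)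
  have B: "B \<in> carrier_mat n m" and BG: "lower_block r (mat_adjoint U * B * V) = lower_block r G'"
    unfolding B_def G'_def using P_Tperp_coordinates[OF U V G r] by auto
  have B': "mat_adjoint U * B * V \<in> carrier_mat n m" using c B by (auto intro!: mult_carrier_mat)
  have "op_bound (spec_norm B) (mat_adjoint U * B * V)"
    by (rule op_bound_unitary[OF op_bound_spec_norm[OF B] B unitary_adj[OF U] V])
  from op_bound_lower_block[OF this B' r] have bB: "op_bound (spec_norm B) (lower_block r G')"
    unfolding BG .
  have "minner G D = minner G' D'"
    using minner_unitary[OF U V G' D] unitary_cancel(2)[OF U V G] by (simp add: G'_def D'_def)
  moreover have "minner G' D' = minner (corner_mask r G') D' + minner (lower_block r G') (lower_block r D')"
    by (rule minner_corner_lower[OF G' D' r])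
  moreover have "minner E D = minner H D'"
    unfolding Ed D'_def by (rule minner_unitary[OF U V H D])
  moreover have "minner (H - corner_mask r G') D' = minner H D' - minner (corner_mask r G') D'"
    by (rule minner_diff_left[OF H cG D'])
  \<comment> \<open>The absolute value matters, since this pairing occurs in
    \<open>minner G D - minner E D\<close> with the opposite sign.\<close>
  moreover have "\<bar>minner (H - corner_mask r G') D'\<bar> \<le> spec_norm A * sqrt (2 * real r) * fro_norm D"
    using minner_corner_le[OF bA HG D' r] fro_norm_unitary[OF U V D] unfolding mask D'_def[symmetric] by simp
  moreover have "minner (lower_block r G') (lower_block r D') \<le> spec_norm B * nuc_norm (lower_block r D')"
    by (rule minner_le_op_bound_nuc_norm[OF bB lower_block_carrier[OF G'] lower_block_carrier[OF D']])
  ultimately show ?thesis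
    unfolding M_def A_def[symmetric] B_def[symmetric] D'_def[symmetric] by linarith
qed

section \<open>Sampling sums, the spectral operator and the final comparison\<close>

lemma msum_carrier [simp]: "msum n m g A \<in> carrier_mat n m"
  by (simp add: msum_def)

lemma minner_msum_left:
  assumes "\<And>k. k \<in> A \<Longrightarrow> g k \<in> carrier_mat n m" and Y: "Y \<in> carrier_mat n m"
  shows "minner (msum n m g A) Y = (\<Sum>k\<in>A. minner (g k) Y)"
proof -
  have "minner (msum n m g A) Y = (\<Sum>i<n. \<Sum>j<m. \<Sum>k\<in>A. Re (cnj (g k $$ (i, j)) * Y $$ (i, j)))"
    unfolding minner_entries[OF msum_carrier Y]
    by (intro sum.cong refl) (simp add: msum_def sum_distrib_right sum.distrib)
  also have "\<dots> = (\<Sum>i<n. \<Sum>k\<in>A. \<Sum>j<m. Re (cnj (g k $$ (i, j)) * Y $$ (i, j)))"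
    by (intro sum.cong refl sum.swap)
  also have "\<dots> = (\<Sum>k\<in>A. \<Sum>i<n. \<Sum>j<m. Re (cnj (g k $$ (i, j)) * Y $$ (i, j)))"
    by (rule sum.swap)
  also have "\<dots> = (\<Sum>k\<in>A. minner (g k) Y)"
    using assms by (intro sum.cong refl) (simp only: minner_entries[OF _ Y])
  finally show ?thesis .
qed

lemma Vspace_carrier: "X \<in> Vspace k n m \<Longrightarrow> X \<in> carrier_mat n m"
  by (cases k) (auto simp: Vspace_def)

lemma Vspace_real: "X \<in> Vspace k n m \<Longrightarrow> is_real_kind k \<Longrightarrow> real_entries X"
  by (cases k) (auto simp: Vspace_def is_real_kind_def)

text \<open>Existence of a singular value decomposition within the given kind matters here: without one,
  the choice operator in the spectral operator could return factors of arbitrary dimensions.\<close>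
lemma spectral_op_carrier:
  assumes "X \<in> Vspace k n m"
  shows "spectral_op k f X \<in> carrier_mat n m"
proof -
  have X: "X \<in> carrier_mat n m" by (rule Vspace_carrier[OF assms])
  obtain U V where "is_svd X U (sing_vals X) V" "real_entries X \<longrightarrow> real_entries U \<and> real_entries V"
    using svd_of[OF X] by metis
  then have "is_svd_k k X U (sing_vals X) V"
    using Vspace_real[OF assms] by (auto simp: is_svd_k_def)
  then have "\<exists>p. case p of (U, V) \<Rightarrow> is_svd_k k X U (sing_vals X) V" by auto
  from someI_ex[OF this] obtain U' V' where
    p: "(SOME (U, V). is_svd_k k X U (sing_vals X) V) = (U', V')" and "is_svd_k k X U' (sing_vals X) V'"
    by (metis (mono_tags, lifting) case_prodE)
  then have "U' \<in> carrier_mat n n" "V' \<in> carrier_mat m m"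
    using X by (auto simp: is_svd_k_def is_svd_def unitary_def)
  then show ?thesis
    using X by (auto simp: spectral_op_def p intro!: mult_carrier_mat)
qed

lemma fro_norm_diff_sq:
  assumes "X \<in> carrier_mat n m" "Y \<in> carrier_mat n m"
  shows "(fro_norm (X - Y))\<^sup>2 = (fro_norm X)\<^sup>2 + (fro_norm Y)\<^sup>2 - 2 * minner Y X"
proof -
  have "X - Y \<in> carrier_mat n m" using assms by (simp add: minus_carrier_mat)
  then show ?thesis
    using assms
    by (simp add: fro_norm_sq[of _ n m] minner_diff_left[of _ n m] minner_diff_right[of _ n m]
        minner_commute[of X n m Y])
qed

theorem mainTheorem1:
  fixes k :: space_kind and n1 n2 d m r :: nat
    and \<Theta> :: "nat \<Rightarrow> complex mat" and \<alpha> :: "nat set"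
    and \<omega> :: "nat \<Rightarrow> nat" and \<xi> :: "nat \<Rightarrow> real" and \<nu> :: real
    and Xbar Xt Xh Ub Vb :: "complex mat"
    and f :: "real vec \<Rightarrow> real vec"
    and \<rho> \<gamma> \<kappa> :: real
  assumes basis: "orthonormal_basis (Vspace k n1 n2) d \<Theta>"
    and alpha: "\<alpha> \<subseteq> {1..d}"
    and m_pos: "0 < m"
    and omega: "\<forall>i\<in>{1..m}. \<omega> i \<in> {1..d} - \<alpha>"
    and nu: "\<nu> > 0"
    and Xbar: "Xbar \<in> Vspace k n1 n2" "mat_rank Xbar = r" "r \<ge> 1"
    and svd: "is_svd_k k Xbar Ub (sing_vals Xbar) Vb"
    and f: "symmetric_fun (min n1 n2) f"
    and Xt: "Xt \<in> Vspace k n1 n2"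
    and rho: "\<rho> > 0" and gamma: "\<gamma> \<ge> 0"
    and opt: "RC_feasible (Vspace k n1 n2) \<Theta> \<alpha> Xbar Xh"
             "\<forall>X. RC_feasible (Vspace k n1 n2) \<Theta> \<alpha> Xbar X \<longrightarrow>
                RC_obj \<Theta> m \<omega> (\<lambda>i. minner (\<Theta> (\<omega> i)) Xbar + \<nu> * \<xi> i) \<rho> \<gamma> (spectral_op k f Xt) Xt Xh
                \<le> RC_obj \<Theta> m \<omega> (\<lambda>i. minner (\<Theta> (\<omega> i)) Xbar + \<nu> * \<xi> i) \<rho> \<gamma> (spectral_op k f Xt) Xt X"
    and perp: "spec_norm (P_Tperp (last_cols r Ub) (last_cols r Vb)
                 (spectral_op k f Xt + complex_of_real \<gamma> \<cdot>\<^sub>m Xt)) < 1"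
    and kappa: "\<kappa> > 1"
    and rho_bound: "\<rho> \<ge> \<kappa> * \<nu> / (1 - spec_norm (P_Tperp (last_cols r Ub) (last_cols r Vb)
                 (spectral_op k f Xt + complex_of_real \<gamma> \<cdot>\<^sub>m Xt)))
               * spec_norm (complex_of_real (1 / real m) \<cdot>\<^sub>m R_Omega_adj n1 n2 \<Theta> m \<omega> \<xi>)"
  shows "1 / (2 * real m) * (\<Sum>i=1..m. (minner (\<Theta> (\<omega> i)) (Xh - Xbar))\<^sup>2)
         \<le> sqrt (2 * real r) *
             (spec_norm (first_cols r Ub * mat_adjoint (first_cols r Vb)
                  - P_T (first_cols r Ub) (first_cols r Vb) (spectral_op k f Xt + complex_of_real \<gamma> \<cdot>\<^sub>m Xt))
              + (1 - spec_norm (P_Tperp (last_cols r Ub) (last_cols r Vb)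
                  (spectral_op k f Xt + complex_of_real \<gamma> \<cdot>\<^sub>m Xt))) / \<kappa>)
             * \<rho> * fro_norm (Xh - Xbar)
           + \<rho> * \<gamma> / 2 * ((fro_norm Xbar)\<^sup>2 - (fro_norm Xh)\<^sup>2)"
proof -
  define F where "F = spectral_op k f Xt"
  define G where "G = F + complex_of_real \<gamma> \<cdot>\<^sub>m Xt"
  define D where "D = Xh - Xbar"
  define N where "N = complex_of_real (1 / real m) \<cdot>\<^sub>m R_Omega_adj n1 n2 \<Theta> m \<omega> \<xi>"
  define E where "E = first_cols r Ub * mat_adjoint (first_cols r Vb)"
  define a where "a = spec_norm (E - P_T (first_cols r Ub) (first_cols r Vb) G)"
  define p where "p = spec_norm (P_Tperp (last_cols r Ub) (last_cols r Vb) G)"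
  define M where "M = nuc_norm (lower_block r (mat_adjoint Ub * D * Vb))"
  define q where "q = sqrt (2 * real r) * fro_norm D"
  define t where "t = (\<lambda>i. minner (\<Theta> (\<omega> i)) D)"
  define S where "S = (\<Sum>i=1..m. (t i)\<^sup>2)"
  define T where "T = (\<Sum>i=1..m. \<xi> i * t i)"

  have Xb: "Xbar \<in> carrier_mat n1 n2" and Xtc: "Xt \<in> carrier_mat n1 n2" and Xhc: "Xh \<in> carrier_mat n1 n2"
    using Vspace_carrier Xbar(1) Xt opt(1) by (auto simp: RC_feasible_def)
  have D: "D \<in> carrier_mat n1 n2" using Xb Xhc by (simp add: D_def minus_carrier_mat)
  have F: "F \<in> carrier_mat n1 n2" unfolding F_def by (rule spectral_op_carrier[OF Xt])
  have G: "G \<in> carrier_mat n1 n2" using F Xtc by (simp add: G_def)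
  have N: "N \<in> carrier_mat n1 n2" by (simp add: N_def R_Omega_adj_def)
  have \<Theta>: "\<Theta> (\<omega> i) \<in> carrier_mat n1 n2" if "i \<in> {1..m}" for i
    using basis omega that unfolding orthonormal_basis_def by (blast intro: Vspace_carrier)
  have svd': "is_svd Xbar Ub (sing_vals Xbar) Vb" using svd by (simp add: is_svd_k_def)
  have U: "unitary n1 Ub" and V: "unitary n2 Vb"
    using svd' unfolding is_svd_def carrier_matD[OF Xb] by auto
  have r: "r \<le> n1" "r \<le> n2" using rank_svd(1,2)[OF svd' Xb Xbar(2)] by auto

  have subgrad: "nuc_norm Xbar + minner E D + M \<le> nuc_norm Xh"
    unfolding E_def M_def D_def by (rule nuc_norm_subgradient[OF svd' Xb Xhc Xbar(2)])
  have GE: "minner G D - minner E D \<le> a * q + p * M"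
    using minner_head_minus_le[OF G D U V r] by (simp add: a_def p_def q_def E_def M_def mult.assoc)
  have ND: "minner N D \<le> spec_norm N * (q + M)"
    unfolding q_def M_def by (rule minner_split_le[OF N D U V r])
  \<comment> \<open>This identifies the noise cross term of the least squares part with a linear
    functional of D.\<close>
  have "minner N D = 1 / real m * (\<Sum>i=1..m. minner (complex_of_real (\<xi> i) \<cdot>\<^sub>m \<Theta> (\<omega> i)) D)"
    unfolding N_def R_Omega_adj_def minner_smult_left[OF msum_carrier D]
    by (subst minner_msum_left[OF _ D]) (use \<Theta> in auto)
  also have "\<dots> = T / real m"
    unfolding T_def t_def using \<Theta> by (simp add: minner_smult_left[OF _ D])
  finally have NT: "minner N D = T / real m" .

  have tD: "minner (\<Theta> (\<omega> i)) Xh = minner (\<Theta> (\<omega> i)) Xbar + t i" if "i \<in> {1..m}" for i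
    unfolding t_def D_def minner_diff_right[OF \<Theta>[OF that] Xhc Xb] by simp
  define y where "y = (\<lambda>i. minner (\<Theta> (\<omega> i)) Xbar + \<nu> * \<xi> i)"
  \<comment> \<open>The residual is pure noise at \<open>Xbar\<close>, and at \<open>Xh\<close> each
    component is shifted by \<open>- t i\<close>.\<close>
  have "resid_sq \<Theta> m \<omega> y Xh = (\<Sum>i=1..m. (\<nu> * \<xi> i)\<^sup>2 - 2 * \<nu> * (\<xi> i * t i) + (t i)\<^sup>2)"
    unfolding resid_sq_def y_def
    by (intro sum.cong refl) (simp only: tD, simp add: power2_eq_square algebra_simps)
  also have "\<dots> = resid_sq \<Theta> m \<omega> y Xbar - 2 * \<nu> * T + S"
    unfolding sum.distrib sum_subtractf T_def S_def resid_sq_def y_def by (simp add: sum_distrib_left)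
  finally have resid: "resid_sq \<Theta> m \<omega> y Xh = resid_sq \<Theta> m \<omega> y Xbar - 2 * \<nu> * T + S" .

  \<comment> \<open>The squared norm of \<open>Xt\<close> cancels. What is left is linear in D, to
    be merged with F into G, plus the difference of norms kept in the claim.\<close>
  have fro: "(fro_norm (Xh - Xt))\<^sup>2 - (fro_norm (Xbar - Xt))\<^sup>2
      = (fro_norm Xh)\<^sup>2 - (fro_norm Xbar)\<^sup>2 - 2 * minner Xt D"
    unfolding fro_norm_diff_sq[OF Xhc Xtc] fro_norm_diff_sq[OF Xb Xtc] D_def minner_diff_right[OF Xtc Xhc Xb]
    by simp
  have GD: "minner G D = minner F Xh - minner F Xbar + \<gamma> * minner Xt D"
    unfolding G_def using F Xtc D
    by (simp add: minner_add_left[of _ n1 n2] minner_smult_left[of _ n1 n2] D_def minner_diff_right[OF F Xhc Xb])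

  have "RC_feasible (Vspace k n1 n2) \<Theta> \<alpha> Xbar Xbar"
    using Xbar(1) by (simp add: RC_feasible_def)
  then have "RC_obj \<Theta> m \<omega> y \<rho> \<gamma> F Xt Xh \<le> RC_obj \<Theta> m \<omega> y \<rho> \<gamma> F Xt Xbar"
    using opt(2) unfolding F_def y_def by blast
  then have "1 / (2 * real m) * S - \<nu> * (T / real m)
      + \<rho> * (nuc_norm Xh - nuc_norm Xbar - (minner F Xh - minner F Xbar)
        + \<gamma> / 2 * ((fro_norm (Xh - Xt))\<^sup>2 - (fro_norm (Xbar - Xt))\<^sup>2)) \<le> 0"
    unfolding RC_obj_def resid using m_pos by (simp add: algebra_simps add_divide_distrib diff_divide_distrib)
  then have "1 / (2 * real m) * S - \<nu> * minner N D + \<rho> * (nuc_norm Xh - nuc_norm Xbar - minner G D)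
      - \<rho> * \<gamma> / 2 * ((fro_norm Xbar)\<^sup>2 - (fro_norm Xh)\<^sup>2) \<le> 0"
    unfolding fro NT GD by (simp add: algebra_simps)
  moreover have "\<rho> * (nuc_norm Xh - nuc_norm Xbar - minner G D) \<ge> \<rho> * ((1 - p) * M - a * q)"
    using subgrad GE rho by (intro mult_left_mono) (auto simp: algebra_simps)
  moreover have p1: "0 < 1 - p" using perp by (simp add: p_def G_def F_def)
  \<comment> \<open>The lower bound on \<rho>, solved for the noise level. The part with q stays in
    the claim, the part with M is removed next.\<close>
  moreover have "\<nu> * minner N D \<le> \<rho> * ((1 - p) / \<kappa>) * (q + M)"
  proof -
    have "\<kappa> * \<nu> / (1 - p) * spec_norm N \<le> \<rho>"
      using rho_bound by (simp add: p_def G_def F_def N_def)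
    then have "\<nu> * spec_norm N \<le> \<rho> * ((1 - p) / \<kappa>)"
      using p1 kappa by (simp add: field_simps)
    moreover have "0 \<le> q + M"
      unfolding q_def M_def by (intro add_nonneg_nonneg mult_nonneg_nonneg fro_norm_nonneg nuc_norm_nonneg) simp
    ultimately have "\<nu> * spec_norm N * (q + M) \<le> \<rho> * ((1 - p) / \<kappa>) * (q + M)"
      by (rule mult_right_mono)
    moreover have "\<nu> * minner N D \<le> \<nu> * (spec_norm N * (q + M))"
      using ND nu by (intro mult_left_mono) auto
    ultimately show ?thesis by (simp add: mult.assoc)
  qed
  \<comment> \<open>Here \<kappa> > 1 is used: the gain (1 - p) M left by the subgradient inequality
    dominates the noise on the lower block, and M drops out.\<close>
  moreover have "\<rho> * ((1 - p) / \<kappa>) * M \<le> \<rho> * ((1 - p) * M)"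
  proof -
    have "(1 - p) / \<kappa> \<le> 1 - p"
      using p1 kappa mult_left_mono[of 1 \<kappa> "1 - p"] by (simp add: divide_le_eq)
    then have "(1 - p) / \<kappa> * M \<le> (1 - p) * M"
      by (rule mult_right_mono) (simp add: M_def nuc_norm_nonneg)
    then show ?thesis
      unfolding mult.assoc using rho by (intro mult_left_mono) auto
  qed
  ultimately have "1 / (2 * real m) * S \<le> q * (a + (1 - p) / \<kappa>) * \<rho>
      + \<rho> * \<gamma> / 2 * ((fro_norm Xbar)\<^sup>2 - (fro_norm Xh)\<^sup>2)"
    by (simp add: algebra_simps add_divide_distrib diff_divide_distrib)
  then show ?thesis
    by (simp add: S_def t_def q_def a_def p_def E_def G_def F_def D_def mult_ac)
qed

end
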